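(* Let $f\in C(E)$ and $x\in E\setminus E_0$. Then $$\lim_{T\to+\infty}\frac1T\int_0^T f(X_t)\,dt=\pi(f)\qquad\text{in }\mathbb P_x\text{ probability},$$ where $\pi$ is the probability on $E$ defined in the context and $\pi(f)=\int f\,d\pi$. Moreover, the convergence is uniform with respect to $x$ in a compact subset of $E\setminus E_0$, i.e. for every compact $E_1\subset E\setminus E_0$ and $\varepsilon>0$, $\sup_{x\in E_1}\mathbb P_x\big(\big|\frac1T\int_0^Tf(X_t)\,dt-\pi(f)\big|>\varepsilon\big)\to0$ as $T\to+\infty$.
   Context: Setting. $E$ is a compact Polish space with its Borel $\sigma$-algebra; $C(E)$, $C(E\times E)$ are the spaces of continuous functions. Consider the continuous time Markov chain on $E$ with transition rates $c(x,dy)=r(x)p(x,dy)$, where $r\colon E\to\mathbb R_+=[0,+\infty)$ and $p$ is a transition kernel on $E$ (in state $x$ the chain waits an exponential time of parameter $r(x)$, infinite if $r(x)=0$, then jumps according to $p(x,dy)$). $\mathbb P_x$ is its law with initial state $x$, a probability on the Skorokhod space $D(\mathbb R_+;E)$ with canonical coordinate $X_t$. Standing assumptions: (i) $r$ is continuous; set $E_0:=\{x\in E: r(x)=0\}$. (ii) There is a probability $\lambda$ on $E$, strictly positive on (nonempty) open sets, such that $p(x,dy)=p(x,y)\lambda(dy)$ for some strictly positive density $p\in C(E\times E)$. (iii) $\int\lambda(dx)\,1/r(x)<+\infty$. (iv) With $A_\delta:=\{x\in E: r(x)<\delta\}$, there is a sequence $\delta_n\to0$ ($\delta_n>0$) such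 that $\sup_n\lambda(A_{2\delta_n})/\lambda(A_{2\delta_n}\setminus A_{\delta_n})<+\infty$ (a condition the paper introduces for the large deviations lower bound). Invariant measure. By (ii) the discrete time chain with kernel $p$ is uniformly ergodic; $\pi_0$ denotes its unique invariant probability, and $\pi_0(1/r)<+\infty$. Then $\pi(dx):=\frac1{\pi_0(1/r)}\frac{\pi_0(dx)}{r(x)}$, a probability on $E$. *)

theory Defs
  imports "HOL-Probability.Probability"
begin

text \<open>
  The Skorokhod space of right-continuous paths with left limits. The Borel \<open>\<sigma>\<close>-algebra of the
  Skorokhod topology is the one generated by the coordinates, which is what is used here. Paths are
  extensional on the half-line, i.e. carry no information at negative times.
\<close>

definition cadlag_paths :: "(real \<Rightarrow> 'a::topological_space) set" where
  "cadlag_paths = {w \<in> extensional {0..}.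
     (\<forall>t\<ge>0. continuous (at_right t) w) \<and> (\<forall>t>0. \<exists>l. (w \<longlongrightarrow> l) (at_left t))}"

definition skorokhod_space :: "(real \<Rightarrow> 'a::topological_space) measure" where
  "skorokhod_space = restrict_space (PiM {0..} (\<lambda>_. borel)) cadlag_paths"

definition holding_law :: "real \<Rightarrow> ennreal measure" where
  "holding_law c = (if c = 0 then return borel \<infinity>
     else distr (density lborel (\<lambda>s. ennreal (exponential_density c s))) borel ennreal)"

text \<open>Draw a state from \<open>\<mu>\<close>, then the time spent there.\<close>

definition with_holding ::
    "('a::topological_space \<Rightarrow> real) \<Rightarrow> 'a measure \<Rightarrow> ('a \<times> ennreal) measure" where
  "with_holding r \<mu> = \<mu> \<bind> (\<lambda>y. distr (holding_law (r y)) (borel \<Otimes>\<^sub>M borel) (Pair y))"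

text \<open>
  Law of the sequence (visited state, holding time), by the Ionescu-Tulcea theorem. States are
  indexed by attempted jumps, since the kernel may charge the current state.
\<close>

definition skeleton_law ::
    "('a::topological_space \<Rightarrow> real) \<Rightarrow> ('a \<Rightarrow> 'a measure) \<Rightarrow> 'a \<Rightarrow> (nat \<Rightarrow> 'a \<times> ennreal) measure" where
  "skeleton_law r K x =
     (let M = (\<lambda>_. borel \<Otimes>\<^sub>M borel);
          P = (\<lambda>n w. with_holding r (if n = 0 then return borel x else K (fst (w (n - 1)))))
      in projective_family.lim UNIV (Ionescu_Tulcea.CI P M) M)"

definition jump_time :: "(nat \<Rightarrow> 'a \<times> ennreal) \<Rightarrow> nat \<Rightarrow> ennreal" where
  "jump_time w n = (\<Sum>k<n. snd (w k))"

text \<open>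
  At time \<open>t\<close> the path sits in the \<open>n\<close>-th state, where
  \<open>jump_time w n \<le> t < jump_time w (Suc n)\<close>. Explosive sequences, which form a null set for
  bounded rates, get a constant path so that every path is in the Skorokhod space.
\<close>

definition skeleton_path :: "(nat \<Rightarrow> 'a \<times> ennreal) \<Rightarrow> real \<Rightarrow> 'a" where
  "skeleton_path w = (\<lambda>t\<in>{0..}. if (SUP n. jump_time w n) = \<infinity>
     then fst (w (LEAST n. ennreal t < jump_time w (Suc n))) else fst (w 0))"

definition ctmc_law ::
    "('a::topological_space \<Rightarrow> real) \<Rightarrow> ('a \<Rightarrow> 'a measure) \<Rightarrow> 'a \<Rightarrow> (real \<Rightarrow> 'a) measure" where
  "ctmc_law r K x = distr (skeleton_law r K x) skorokhod_space skeleton_path"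

definition invariant_prob :: "('a::topological_space \<Rightarrow> 'a measure) \<Rightarrow> 'a measure \<Rightarrow> bool" where
  "invariant_prob K \<mu> \<longleftrightarrow> prob_space \<mu> \<and> sets \<mu> = sets borel \<and> \<mu> \<bind> K = \<mu>"

definition skeleton_invariant :: "('a::topological_space \<Rightarrow> 'a measure) \<Rightarrow> 'a measure" where
  "skeleton_invariant K = (THE \<mu>. invariant_prob K \<mu>)"

text \<open>Reciprocals of rates are taken in \<^typ>\<open>ennreal\<close>, where \<open>1 / 0 = \<infinity>\<close>.\<close>

definition ctmc_invariant ::
    "('a::topological_space \<Rightarrow> real) \<Rightarrow> ('a \<Rightarrow> 'a measure) \<Rightarrow> 'a measure" where
  "ctmc_invariant r K = (let \<pi>0 = skeleton_invariant K in
     density \<pi>0 (\<lambda>x. 1 / ennreal (r x) / (\<integral>\<^sup>+y. 1 / ennreal (r y) \<partial>\<pi>0)))"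

definition slow_set :: "('a \<Rightarrow> real) \<Rightarrow> real \<Rightarrow> 'a set" where
  "slow_set r d = {x. r x < d}"

definition time_average :: "('a \<Rightarrow> real) \<Rightarrow> real \<Rightarrow> (real \<Rightarrow> 'a) \<Rightarrow> real" where
  "time_average f T w = 1 / T * (LINT t:{0..T}|lborel. f (w t))"

text \<open>The law \<^const>\<open>ctmc_law\<close> is a genuine probability on the Skorokhod space.\<close>

lemma holding_law_measurable:
  assumes r[measurable]: "r \<in> borel_measurable M" and nn: "\<And>x. 0 \<le> r x"
  shows "(\<lambda>x. holding_law (r x)) \<in> M \<rightarrow>\<^sub>M prob_algebra borel"
proof (rule measurable_prob_algebraI)
  have ps: "prob_space (holding_law c)" if "0 \<le> c" for c
    using that prob_space_exponential_density[of c] unfolding holding_law_def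
    by (auto intro!: prob_space.prob_space_distr prob_space_return)
  then show "prob_space (holding_law (r x))" for x using nn by auto
  show "(\<lambda>x. holding_law (r x)) \<in> M \<rightarrow>\<^sub>M subprob_algebra borel"
  proof (rule measurable_subprob_algebra)
    fix a show "subprob_space (holding_law (r a))" by (intro prob_space_imp_subprob_space ps nn)
    show "sets (holding_law (r a)) = sets borel" by (simp add: holding_law_def)
  next
    fix A :: "ennreal set" assume A[measurable]: "A \<in> sets borel"
    have "(\<lambda>a. emeasure (holding_law (r a)) A) =
      (\<lambda>a. if r a = 0 then indicator A \<infinity> else
         \<integral>\<^sup>+s. ennreal (if s < 0 then 0 else r a * exp (- s * r a)) * indicator (ennreal -` A) s \<partial>lborel)"
    proof -
      have m: "ennreal -` A \<in> sets borel" using measurable_sets_borel[OF measurable_ennreal A] by simp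
      have m2: "(\<lambda>s. ennreal (exponential_density c s)) \<in> borel_measurable lborel" for c by simp
      show ?thesis
        unfolding fun_eq_iff
        using emeasure_density[OF m2, of "ennreal -` A"] m
        by (auto simp: holding_law_def emeasure_distr exponential_density_def simp del: emeasure_density)
    qed
    also have "\<dots> \<in> borel_measurable M" by measurable
    finally show "(\<lambda>a. emeasure (holding_law (r a)) A) \<in> borel_measurable M" .
  qed
qed

lemma with_holding_measurable:
  fixes r :: "'a::polish_space \<Rightarrow> real"
  assumes r[measurable]: "r \<in> borel_measurable borel" and nn: "\<And>x. 0 \<le> r x"
  and k[measurable]: "k \<in> M \<rightarrow>\<^sub>M prob_algebra borel"
  shows "(\<lambda>x. with_holding r (k x)) \<in> M \<rightarrow>\<^sub>M prob_algebra (borel \<Otimes>\<^sub>M borel)"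
proof -
  note [measurable] = holding_law_measurable[OF r nn]
  show ?thesis unfolding with_holding_def by measurable
qed

locale jump_kernel = 
  fixes r :: "'a::polish_space \<Rightarrow> real" and K :: "'a \<Rightarrow> 'a measure"
  assumes r[measurable]: "r \<in> borel_measurable borel" and nn: "\<And>x. 0 \<le> r x"
    and K[measurable]: "K \<in> borel \<rightarrow>\<^sub>M prob_algebra borel"
begin

abbreviation "step x \<equiv> (\<lambda>n w. with_holding r (if n = 0 then return borel x else K (fst (w (n - 1)))))"
abbreviation "M \<equiv> (\<lambda>_::nat. borel \<Otimes>\<^sub>M borel) :: nat \<Rightarrow> ('a \<times> ennreal) measure"

lemma Ionescu_Tulcea_step: "Ionescu_Tulcea (step x) M"
proof -
  have *: "step x i \<in> PiM {0..<i} M \<rightarrow>\<^sub>M prob_algebra (M i)" for i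
  proof (cases "i = 0")
    case True
    have "(\<lambda>_. return borel x) \<in> PiM {0..<i} M \<rightarrow>\<^sub>M prob_algebra borel" by measurable
    from with_holding_measurable[OF r nn this] True show ?thesis by simp
  next
    case False
    then have [measurable]: "(\<lambda>w. w (i - 1)) \<in> PiM {0..<i} M \<rightarrow>\<^sub>M (borel \<Otimes>\<^sub>M borel)"
      by (intro measurable_component_singleton) auto
    have "(\<lambda>w. K (fst (w (i - 1)))) \<in> PiM {0..<i} M \<rightarrow>\<^sub>M prob_algebra borel" by measurable
    from with_holding_measurable[OF r nn this] False show ?thesis by simp
  qed
  have pr: "prob_space (step x i w)" if "w \<in> space (PiM {0..<i} M)" for i w
    using measurable_space[OF * that] by (simp add: space_prob_algebra)
  show ?thesis
    by (rule Ionescu_Tulcea.intro) (rule measurable_prob_algebraD[OF *], rule pr)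
qed

sublocale IT: Ionescu_Tulcea "step x" M for x by (rule Ionescu_Tulcea_step)

lemma skeleton_law_eq: "skeleton_law r K x = IT.PF.lim x" by (simp add: skeleton_law_def Let_def)

lemma prob_space_skeleton_law: "prob_space (skeleton_law r K x)"
  unfolding skeleton_law_eq
proof 
  have "prob_space (distr (IT.PF.lim x) (PiM {} M) (\<lambda>w. restrict w {}))"
    using IT.PF.prob_space_P[of "{}" x] by (subst IT.distr_lim) auto
  then have "prob_space (IT.PF.lim x)"
    by (rule prob_space_distrD[rotated])
      (auto intro!: measurable_restrict simp: measurable_cong_sets[OF IT.PF.sets_lim refl])
  then show "emeasure (IT.PF.lim x) (space (IT.PF.lim x)) = 1" by (rule prob_space.emeasure_space_1)
qed

lemma sets_skeleton_law: "sets (skeleton_law r K x) = sets (PiM UNIV M)"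
  by (simp add: skeleton_law_eq)

end

lemma mono_jump_time: "mono (jump_time w)"
  by (rule monoI) (auto simp: jump_time_def intro!: sum_mono2)

lemma skeleton_path_eq:
  assumes s: "jump_time w n \<le> ennreal t" "ennreal t < jump_time w (Suc n)" "0 \<le> t"
    and inf: "(SUP n. jump_time w n) = \<infinity>"
  shows "skeleton_path w t = fst (w n)"
proof -
  have "(LEAST n. ennreal t < jump_time w (Suc n)) = n"
  proof (rule Least_equality)
    fix y assume y: "ennreal t < jump_time w (Suc y)"
    show "n \<le> y"
    proof (rule ccontr)
      assume "\<not> n \<le> y" then have "Suc y \<le> n" by simp
      from monoD[OF mono_jump_time this, of w] y s show False by (meson leD less_le_trans order_trans)
    qed
  qed (use s in auto)
  then show ?thesis using s inf by (simp add: skeleton_path_def)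
qed

lemma ex_jump_index:
  assumes inf: "(SUP n. jump_time w n) = \<infinity>"
  shows "\<exists>n. jump_time w n \<le> ennreal t \<and> ennreal t < jump_time w (Suc n)"
proof -
  have "\<exists>n. ennreal t < jump_time w n" using inf less_SUP_iff[of "ennreal t" "jump_time w" UNIV] by simp
  then have ex: "\<exists>n. ennreal t < jump_time w (Suc n)"
    by (meson mono_jump_time lessI less_imp_le less_le_trans monoD)
  define n where "n = (LEAST n. ennreal t < jump_time w (Suc n))"
  have 1: "ennreal t < jump_time w (Suc n)" unfolding n_def by (rule LeastI_ex[OF ex])
  have 2: "jump_time w n \<le> ennreal t"
  proof (cases n)
    case 0 then show ?thesis by (simp add: jump_time_def)
  next
    case (Suc m) then show ?thesis using not_less_Least[of m "\<lambda>n. ennreal t < jump_time w (Suc n)"]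
      unfolding n_def by simp
  qed
  show ?thesis using 1 2 by blast
qed

lemma skeleton_path_cadlag: "skeleton_path w \<in> cadlag_paths"
proof (cases "(SUP n. jump_time w n) = \<infinity>")
  case False
  have ev: "\<forall>\<^sub>F s in at_left t. s \<in> {0..}" if "0 < t" for t :: real
    using eventually_at_left_real[OF that] by eventually_elim auto
  have "(skeleton_path w \<longlongrightarrow> fst (w 0)) (at_right t)" if "0 \<le> t" for t
    using that False eventually_at_right_less[of t]
    by (intro tendsto_eventually) (auto simp: skeleton_path_def elim!: eventually_mono)
  moreover have "(skeleton_path w \<longlongrightarrow> fst (w 0)) (at_left t)" if "0 < t" for t
    using False ev[OF that]
    by (intro tendsto_eventually) (auto simp: skeleton_path_def elim!: eventually_mono)
  ultimately show ?thesis using False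
    by (auto simp: cadlag_paths_def skeleton_path_def continuous_within )
next
  case inf: True
  have R: "continuous (at_right t) (skeleton_path w)" if t: "0 \<le> t" for t
  proof -
    obtain n where n: "jump_time w n \<le> ennreal t" "ennreal t < jump_time w (Suc n)"
      using ex_jump_index[OF inf] by blast
    obtain b where b: "t < b" "ennreal b < jump_time w (Suc n)"
    proof (cases "jump_time w (Suc n)")
      case top then show ?thesis using that[of "t+1"] by simp
    next
      case (real a) 
      with n t have "t < a" by (simp add: ennreal_less_iff)
      then obtain b where "t < b" "b < a" using dense by blast
      then show ?thesis using that[of b] real t by (simp add: ennreal_less_iff)
    qed
    have "\<forall>\<^sub>F s in at_right t. skeleton_path w s = fst (w n)"
      using eventually_at_right_real[OF b(1)]
    proof eventually_elim
      case (elim s)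
      have "ennreal t \<le> ennreal s" "ennreal s \<le> ennreal b" using elim by (auto intro!: ennreal_leI)
      then show ?case using skeleton_path_eq[of w n s] inf n b t elim by (meson atLeastAtMost_iff greaterThanLessThan_iff le_less_trans less_imp_le order_trans)
    qed
    then show ?thesis using skeleton_path_eq[OF n t inf] by (simp add: continuous_within tendsto_eventually)
  qed
  have L: "\<exists>l. (skeleton_path w \<longlongrightarrow> l) (at_left t)" if t: "0 < t" for t
  proof -
    have ex: "\<exists>n. ennreal t \<le> jump_time w (Suc n)" using ex_jump_index[OF inf, of t] by (auto intro: less_imp_le)
    define n where "n = (LEAST n. ennreal t \<le> jump_time w (Suc n))"
    have 1: "ennreal t \<le> jump_time w (Suc n)" unfolding n_def by (rule LeastI_ex[OF ex])
    have 2: "jump_time w n < ennreal t"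
    proof (cases n)
      case 0 then show ?thesis using t by (simp add: jump_time_def)
    next
      case (Suc m) then show ?thesis using not_less_Least[of m "\<lambda>n. ennreal t \<le> jump_time w (Suc n)"]
        unfolding n_def by simp
    qed
    then obtain a where a: "jump_time w n = ennreal a" "0 \<le> a" "a < t"
      using t by (cases "jump_time w n") (auto simp: ennreal_less_iff)
    have "\<forall>\<^sub>F s in at_left t. skeleton_path w s = fst (w n)"
      using eventually_at_left_real[OF a(3)]
    proof eventually_elim
      case (elim s)
      then have "ennreal a \<le> ennreal s" "ennreal s < ennreal t" using a by (auto intro!: ennreal_leI simp: ennreal_less_iff)
      then show ?case using skeleton_path_eq[of w n s] inf 1 a elim by auto
    qed
    then show ?thesis by (auto intro: tendsto_eventually)
  qed
  show ?thesis using R L by (auto simp: cadlag_paths_def) (simp add: skeleton_path_def)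
qed

context jump_kernel begin

lemma skeleton_path_measurable: "skeleton_path \<in> skeleton_law r K x \<rightarrow>\<^sub>M skorokhod_space"
proof -
  have [measurable]: "(\<lambda>w. jump_time w n) \<in> borel_measurable (PiM UNIV M)" for n
    unfolding jump_time_def by measurable
  have [measurable]: "(\<lambda>w. fst (w (n::nat))) \<in> PiM UNIV M \<rightarrow>\<^sub>M borel" for n by measurable
  have [measurable]: "(\<lambda>w. LEAST n. ennreal t < jump_time w (Suc n)) \<in> PiM UNIV M \<rightarrow>\<^sub>M count_space UNIV" for t
    by measurable
  have "skeleton_path \<in> PiM UNIV M \<rightarrow>\<^sub>M PiM {0..} (\<lambda>_. borel)"
    unfolding skeleton_path_def[abs_def]
  proof (rule measurable_restrict)
    fix t :: real
    have [measurable]: "(\<lambda>w. fst (w (LEAST n. ennreal t < jump_time w (Suc n)))) \<in> PiM UNIV M \<rightarrow>\<^sub>M borel"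
      by (rule measurable_compose_countable[where f="\<lambda>n w. fst (w n)"]) measurable
    show "(\<lambda>w. if (SUP n. jump_time w n) = \<infinity>
     then fst (w (LEAST n. ennreal t < jump_time w (Suc n))) else fst (w 0)) \<in> PiM UNIV M \<rightarrow>\<^sub>M borel" by measurable
  qed
  then show ?thesis unfolding skorokhod_space_def
    using skeleton_path_cadlag by (auto intro!: measurable_restrict_space2 simp: measurable_cong_sets[OF sets_skeleton_law refl])
qed

lemma prob_space_ctmc_law: "prob_space (ctmc_law r K x)"
  unfolding ctmc_law_def by (intro prob_space.prob_space_distr prob_space_skeleton_law skeleton_path_measurable)

end

end

theory Submission
  imports Defs
begin

text \<open>
  The pairs (visited state, holding time) form a Markov chain satisfying Doeblin's condition, because
  \<open>p\<close> is bounded below on the compact space. For a bounded function of the pair, a finite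
  approximation of the solution of Poisson's equation turns its partial sums into a martingale
  with bounded increments up to a small error, which gives a weak law of large numbers uniformly in the initial
  state. Truncation extends it to \<open>g(Y\<^sub>k) S\<^sub>k\<close>, where only the mean of the holding times \<open>S\<^sub>k\<close> is finite.
  Let \<open>m\<close> be the stationary mean of the holding time, \<open>h = f - \<pi>(f)\<close>, and take the deterministic index
  \<open>n = \<lfloor>T/m\<rfloor>\<close>. Then the integral of \<open>h\<close> along the path up to \<open>T\<close> differs from the sum of the
  \<open>h(Y\<^sub>k) S\<^sub>k\<close>, \<open>k < n\<close>, by at most \<open>sup |h|\<close> times the distance from \<open>T\<close> to the \<open>n\<close>-th jump time; by the
  weak law, both are \<open>o(T)\<close> in probability.
\<close>

section \<open>Doeblin kernels\<close>

text \<open>The initial state is felt only in the first holding time, whose mean is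
  \<open>1 / r x\<close>. From index 1 on, whatever the past, the conditional law of a pair is at
  most \<open>C\<close> times \<open>\<Lambda>\<close>, with \<open>C\<close> the maximum of
  \<open>p\<close>. A bound \<open>b \<le> r x\<close> therefore suffices for uniformity, and
  \<open>r\<close> has such a bound on a compact set without zeros. With \<open>c\<close> the
  minimum of \<open>p\<close>, each step contracts oscillations by the factor \<open>1 - c\<close>.
  The approximate solution of Poisson's equation is a partial Neumann sum:
  \<open>u = (\<Sum>j<N. Q^j \<phi>)\<close> gives \<open>u - Q u = \<phi> - Q^N \<phi>\<close>, and
  \<open>Q^N \<phi>\<close> is uniformly close to the stationary mean. The truncation error is
  controlled in mean, through \<open>C\<close> and \<open>\<Lambda>\<close>: \<open>1 / r\<close> is
  integrable, but its square need not be. A deterministic index avoids any study of the number of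
  jumps before \<open>T\<close>. The limit is \<open>\<pi>(f)\<close> because the stationary mean of
  \<open>f(Y) S\<close> is \<open>m \<pi>(f)\<close>, so that \<open>h(Y) S\<close> is centred.
  Since \<open>skeleton_invariant\<close> is a definite description, the invariant law of
  \<open>K\<close> must be shown both to exist and to be unique.\<close>

locale doeblin_kernel =
  fixes N :: "'z measure" and Q :: "'z \<Rightarrow> 'z measure" and \<nu> :: "'z measure" and c :: real
  assumes Q[measurable]: "Q \<in> N \<rightarrow>\<^sub>M prob_algebra N"
    and prob_\<nu>: "prob_space \<nu>"
    and sets_\<nu>: "sets \<nu> = sets N"
    and c_pos: "0 < c"
    and minorization: "\<And>z g. z \<in> space N \<Longrightarrow> g \<in> borel_measurable N \<Longrightarrow>
      ennreal c * (\<integral>\<^sup>+y. g y \<partial>\<nu>) \<le> (\<integral>\<^sup>+y. g y \<partial>Q z)"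
begin

definition op :: "('z \<Rightarrow> real) \<Rightarrow> 'z \<Rightarrow> real" where
  "op \<psi> z = (\<integral>y. \<psi> y \<partial>Q z)"

lemma prob_Q: "z \<in> space N \<Longrightarrow> prob_space (Q z)"
  using measurable_space[OF Q] by (simp add: space_prob_algebra)

lemma sets_Q: "z \<in> space N \<Longrightarrow> sets (Q z) = sets N"
  using measurable_space[OF Q] by (simp add: space_prob_algebra)

lemma space_Q: "z \<in> space N \<Longrightarrow> space (Q z) = space N"
  by (rule sets_eq_imp_space_eq[OF sets_Q])

lemma space_\<nu>: "space \<nu> = space N"
  by (rule sets_eq_imp_space_eq[OF sets_\<nu>])

text \<open>Test the minorization on the constant 1, where both measures have mass 1. A point
  \<open>z\<close> is required because \<open>Q z\<close> is a probability only on the space of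
  \<open>N\<close>.\<close>

lemma c_le_1:
  assumes "z \<in> space N" shows "c \<le> 1"
  using minorization[OF assms, of "\<lambda>_. 1"] prob_space.emeasure_space_1[OF prob_Q[OF assms]]
    prob_space.emeasure_space_1[OF prob_\<nu>] by simp

lemma op_measurable[measurable]:
  "\<psi> \<in> borel_measurable N \<Longrightarrow> op \<psi> \<in> borel_measurable N"
  unfolding op_def[abs_def]
  by (rule measurable_compose[OF measurable_prob_algebraD[OF Q] integral_measurable_subprob_algebra])

lemma integrable_bounded:
  assumes "prob_space \<mu>" "sets \<mu> = sets N" "\<psi> \<in> borel_measurable N"
    "\<And>z. z \<in> space N \<Longrightarrow> a \<le> \<psi> z" "\<And>z. z \<in> space N \<Longrightarrow> \<psi> z \<le> (b::real)"
  shows "integrable \<mu> \<psi>"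
proof -
  interpret prob_space \<mu> by fact
  have sp: "space \<mu> = space N" using assms(2) by (rule sets_eq_imp_space_eq)
  show ?thesis
    using assms(3-5) sp
    by (intro integrable_const_bound[where B="max \<bar>a\<bar> \<bar>b\<bar>"])
       (auto simp: measurable_cong_sets[OF assms(2) refl] intro!: AE_I2, fastforce)
qed

lemma minorization_integral:
  assumes z: "z \<in> space N" and [measurable]: "\<psi> \<in> borel_measurable N"
    and "\<And>y. y \<in> space N \<Longrightarrow> 0 \<le> \<psi> y" "\<And>y. y \<in> space N \<Longrightarrow> \<psi> y \<le> b"
  shows "c * (\<integral>y. \<psi> y \<partial>\<nu>) \<le> op \<psi> z"
proof -
  have i1: "integrable \<nu> \<psi>" and i2: "integrable (Q z) \<psi>"
    using assms prob_\<nu> sets_\<nu> prob_Q[OF z] sets_Q[OF z]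
    by (auto intro!: integrable_bounded[where a=0 and b=b])
  have "ennreal c * (\<integral>\<^sup>+y. ennreal (\<psi> y) \<partial>\<nu>) \<le> (\<integral>\<^sup>+y. ennreal (\<psi> y) \<partial>Q z)"
    by (rule minorization[OF z]) measurable
  moreover have nn: "0 \<le> (\<integral>y. \<psi> y \<partial>\<nu>)" "0 \<le> (\<integral>y. \<psi> y \<partial>Q z)"
    using assms(3) by (auto intro!: integral_nonneg_AE AE_I2 simp: space_\<nu> space_Q[OF z])
  moreover have "(\<integral>\<^sup>+y. ennreal (\<psi> y) \<partial>\<nu>) = ennreal (\<integral>y. \<psi> y \<partial>\<nu>)"
    "(\<integral>\<^sup>+y. ennreal (\<psi> y) \<partial>Q z) = ennreal (\<integral>y. \<psi> y \<partial>Q z)"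
    using assms(3) i1 i2
    by (auto intro!: nn_integral_eq_integral AE_I2 simp: space_\<nu> space_Q[OF z])
  ultimately show ?thesis
    using c_pos by (simp add: op_def flip: ennreal_mult)
qed

lemma op_bounds:
  assumes z: "z \<in> space N" and "\<psi> \<in> borel_measurable N"
    and "\<And>y. y \<in> space N \<Longrightarrow> a \<le> \<psi> y" "\<And>y. y \<in> space N \<Longrightarrow> \<psi> y \<le> b"
  shows "a \<le> op \<psi> z" "op \<psi> z \<le> b"
proof -
  interpret prob_space "Q z" by (rule prob_Q[OF z])
  have i: "integrable (Q z) \<psi>"
    using assms prob_Q sets_Q by (auto intro!: integrable_bounded[where a=a and b=b])
  show "a \<le> op \<psi> z" "op \<psi> z \<le> b"
    using i assms unfolding op_def
    by (auto intro!: integral_ge_const integral_le_const AE_I2 simp: space_Q)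
qed

text \<open>Both \<open>\<psi> - a\<close> and \<open>a + d - \<psi>\<close> are nonnegative, so the
  minorization applies to each. It bounds \<open>op \<psi>\<close> from below and from above by
  quantities in which only the \<open>\<nu>\<close>-mean of \<open>\<psi>\<close> appears, and their
  distance is \<open>(1 - c) * d\<close>.\<close>

lemma op_oscillation:
  assumes [measurable]: "\<psi> \<in> borel_measurable N"
    and lb: "\<And>y. y \<in> space N \<Longrightarrow> a \<le> \<psi> y" and ub: "\<And>y. y \<in> space N \<Longrightarrow> \<psi> y \<le> a + d"
  obtains a' where "\<And>z. z \<in> space N \<Longrightarrow> a' \<le> op \<psi> z"
    "\<And>z. z \<in> space N \<Longrightarrow> op \<psi> z \<le> a' + (1 - c) * d"
proof
  interpret \<nu>: prob_space \<nu> by (rule prob_\<nu>)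
  have i1: "integrable \<nu> \<psi>"
    using assms prob_\<nu> sets_\<nu> by (auto intro!: integrable_bounded[where a=a and b="a+d"])
  fix z assume z: "z \<in> space N"
  interpret Qz: prob_space "Q z" by (rule prob_Q[OF z])
  have i2: "integrable (Q z) \<psi>"
    using assms prob_Q[OF z] sets_Q[OF z] by (auto intro!: integrable_bounded[where a=a and b="a+d"])
  \<comment> \<open>This lower end is the witness for \<open>a'\<close>; it depends on
    \<open>\<psi>\<close> but not on \<open>z\<close>.\<close>
  show "a + c * ((\<integral>y. \<psi> y \<partial>\<nu>) - a) \<le> op \<psi> z"
    using minorization_integral[OF z, of "\<lambda>y. \<psi> y - a" d] lb ub i1 i2
    by (simp add: op_def \<nu>.prob_space Qz.prob_space) (smt (verit, best))
  have "c * (\<integral>y. a + d - \<psi> y \<partial>\<nu>) \<le> op (\<lambda>y. a + d - \<psi> y) z"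
    by (rule minorization_integral[OF z, of "\<lambda>y. a + d - \<psi> y" d])
       (use lb ub in \<open>auto simp: algebra_simps\<close>)
  then show "op \<psi> z \<le> a + c * ((\<integral>y. \<psi> y \<partial>\<nu>) - a) + (1 - c) * d"
    using i1 i2 by (simp add: op_def \<nu>.prob_space Qz.prob_space algebra_simps)
qed

lemma iterate_measurable[measurable]:
  "\<psi> \<in> borel_measurable N \<Longrightarrow> (op ^^ n) \<psi> \<in> borel_measurable N"
  by (induction n) auto

lemma iterate_bounds:
  assumes "\<psi> \<in> borel_measurable N"
    and "\<And>y. y \<in> space N \<Longrightarrow> a \<le> \<psi> y" "\<And>y. y \<in> space N \<Longrightarrow> \<psi> y \<le> b" "z \<in> space N"
  shows "a \<le> (op ^^ n) \<psi> z \<and> (op ^^ n) \<psi> z \<le> b"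
  using \<open>z \<in> space N\<close>
proof (induction n arbitrary: z)
  case (Suc n)
  then show ?case using op_bounds[OF Suc.prems, of "(op ^^ n) \<psi>" a b] assms(1) by simp
qed (use assms in auto)

text \<open>The interval containing the values moves with \<open>n\<close> and only its length is
  tracked, hence the existential \<open>a'\<close>.\<close>

lemma iterate_oscillation:
  assumes [measurable]: "\<psi> \<in> borel_measurable N"
    and lb: "\<And>y. y \<in> space N \<Longrightarrow> a \<le> \<psi> y" and ub: "\<And>y. y \<in> space N \<Longrightarrow> \<psi> y \<le> a + d"
  shows "\<exists>a'. \<forall>z\<in>space N. a' \<le> (op ^^ n) \<psi> z \<and> (op ^^ n) \<psi> z \<le> a' + (1 - c) ^ n * d"
proof (induction n)
  case (Suc n)
  then obtain a' where a': "\<And>z. z \<in> space N \<Longrightarrow> a' \<le> (op ^^ n) \<psi> z"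
    "\<And>z. z \<in> space N \<Longrightarrow> (op ^^ n) \<psi> z \<le> a' + (1 - c) ^ n * d" by blast
  obtain a'' where "\<And>z. z \<in> space N \<Longrightarrow> a'' \<le> op ((op ^^ n) \<psi>) z"
    "\<And>z. z \<in> space N \<Longrightarrow> op ((op ^^ n) \<psi>) z \<le> a'' + (1 - c) * ((1 - c) ^ n * d)"
    using op_oscillation[OF iterate_measurable[OF assms(1)] a'] by blast
  then show ?case by (auto simp: mult.assoc intro!: exI[of _ a''])
qed (use lb ub in \<open>auto intro!: exI[of _ a]\<close>)

lemma integral_op:
  assumes \<mu>: "prob_space \<mu>" "sets \<mu> = sets N" and inv: "\<mu> \<bind> Q = \<mu>"
    and [measurable]: "\<psi> \<in> borel_measurable N" and b: "\<And>y. y \<in> space N \<Longrightarrow> \<bar>\<psi> y\<bar> \<le> b"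
  shows "(\<integral>z. op \<psi> z \<partial>\<mu>) = (\<integral>z. \<psi> z \<partial>\<mu>)"
proof -
  interpret prob_space \<mu> by fact
  have sp: "space \<mu> = space N" using \<mu>(2) by (rule sets_eq_imp_space_eq)
  have "(\<integral>z. \<psi> z \<partial>(\<mu> \<bind> Q)) = (\<integral>z. op \<psi> z \<partial>\<mu>)" unfolding op_def
  proof (rule integral_bind[where K=N and B=b and B'=1])
    show "Q \<in> \<mu> \<rightarrow>\<^sub>M subprob_algebra N"
      using measurable_prob_algebraD[OF Q] by (simp add: measurable_cong_sets[OF \<mu>(2) refl])
    show "AE x in \<mu>. emeasure (Q x) (space (Q x)) \<le> ennreal 1"
      using prob_Q by (auto intro!: AE_I2 simp: sp prob_space.emeasure_space_1)
  qed (use b in \<open>auto intro: finite_measure_axioms\<close>)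
  then show ?thesis by (simp add: inv)
qed

text \<open>All iterates have the same \<open>\<mu>\<close>-mean by invariance. That mean and the
  value at \<open>z\<close> lie in one interval of length \<open>(1 - c) ^ n * (2 * b)\<close>,
  where \<open>2 * b\<close> is the length of the initial range from \<open>- b\<close> to
  \<open>b\<close>.\<close>

lemma iterate_convergence:
  assumes \<mu>: "prob_space \<mu>" "sets \<mu> = sets N" and inv: "\<mu> \<bind> Q = \<mu>"
    and [measurable]: "\<psi> \<in> borel_measurable N" and b: "\<And>y. y \<in> space N \<Longrightarrow> \<bar>\<psi> y\<bar> \<le> b"
    and z: "z \<in> space N"
  shows "\<bar>(op ^^ n) \<psi> z - (\<integral>y. \<psi> y \<partial>\<mu>)\<bar> \<le> (1 - c) ^ n * (2 * b)"
proof -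
  interpret prob_space \<mu> by fact
  have sp: "space \<mu> = space N" using \<mu>(2) by (rule sets_eq_imp_space_eq)
  have bb: "\<bar>(op ^^ n) \<psi> y\<bar> \<le> b" if "y \<in> space N" for y n
  proof -
    have "- b \<le> (op ^^ n) \<psi> y \<and> (op ^^ n) \<psi> y \<le> b"
      by (rule iterate_bounds) (use b that in \<open>auto simp: abs_le_iff minus_le_iff\<close>)
    then show ?thesis by auto
  qed
  have "(\<integral>y. (op ^^ n) \<psi> y \<partial>\<mu>) = (\<integral>y. \<psi> y \<partial>\<mu>)"
  proof (induction n)
    case (Suc n)
    then show ?case using integral_op[OF \<mu> inv iterate_measurable[OF assms(4)] bb] by simp
  qed simp
  moreover obtain a where a: "\<And>z. z \<in> space N \<Longrightarrow> a \<le> (op ^^ n) \<psi> z"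
    "\<And>z. z \<in> space N \<Longrightarrow> (op ^^ n) \<psi> z \<le> a + (1 - c) ^ n * (2 * b)"
  proof -
    have "\<psi> y \<le> - b + 2 * b" "- b \<le> \<psi> y" if "y \<in> space N" for y using b[OF that] by auto
    then show ?thesis using that iterate_oscillation[of \<psi> "-b" "2 * b" n] by auto
  qed
  moreover have "integrable \<mu> ((op ^^ n) \<psi>)"
    by (rule integrable_bounded[OF \<mu> _ a]) auto
  then have "a \<le> (\<integral>y. (op ^^ n) \<psi> y \<partial>\<mu>)" "(\<integral>y. (op ^^ n) \<psi> y \<partial>\<mu>) \<le> a + (1 - c) ^ n * (2 * b)"
    using a by (auto intro!: integral_ge_const integral_le_const AE_I2 simp: sp)
  ultimately show ?thesis using a[OF z] by auto
qed

lemma power_contraction_tendsto_0: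
  assumes "z \<in> space N" shows "(\<lambda>n. (1 - c) ^ n * b) \<longlonglongrightarrow> 0"
  using c_le_1[OF assms] c_pos by (intro tendsto_mult_left_zero LIMSEQ_power_zero) auto

text \<open>For a fixed \<open>z\<close>, the iterates of the indicator of \<open>A\<close> at
  \<open>z\<close> converge to the mass of \<open>A\<close> under any invariant probability, so two
  such masses are limits of one sequence.\<close>

lemma invariant_unique:
  assumes \<mu>: "prob_space \<mu>" "sets \<mu> = sets N" "\<mu> \<bind> Q = \<mu>"
    and \<mu>': "prob_space \<mu>'" "sets \<mu>' = sets N" "\<mu>' \<bind> Q = \<mu>'"
  shows "\<mu> = \<mu>'"
proof (rule measure_eqI)
  show "sets \<mu> = sets \<mu>'" using \<mu> \<mu>' by simp
  fix A assume "A \<in> sets \<mu>"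
  then have [measurable]: "A \<in> sets N" using \<mu> by simp
  interpret \<mu>: prob_space \<mu> by fact
  interpret \<mu>': prob_space \<mu>' by fact
  obtain z where z: "z \<in> space N" using \<mu>.not_empty sets_eq_imp_space_eq[OF \<mu>(2)] by auto
  have lim: "(\<lambda>n. (op ^^ n) (indicator A) z) \<longlonglongrightarrow> measure \<rho> A"
    if \<rho>: "prob_space \<rho>" "sets \<rho> = sets N" "\<rho> \<bind> Q = \<rho>" for \<rho>
  proof -
    have m: "(\<integral>y. indicator A y \<partial>\<rho>) = measure \<rho> A"
      using sets.sets_into_space[of A N] sets_eq_imp_space_eq[OF \<rho>(2)]
      by (simp add: Int_absorb2)
    have "norm ((op ^^ n) (indicator A) z - measure \<rho> A) \<le> (1 - c) ^ n * (2 * 1)" for n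
      unfolding m[symmetric] real_norm_def
      by (rule iterate_convergence[OF \<rho> _ _ z]) (auto simp: indicator_def)
    then have "(\<lambda>n. (op ^^ n) (indicator A) z - measure \<rho> A) \<longlonglongrightarrow> 0"
      by (intro Lim_null_comparison[OF _ power_contraction_tendsto_0[OF z]] always_eventually allI)
    then show ?thesis by (rule LIM_zero_cancel)
  qed
  show "emeasure \<mu> A = emeasure \<mu>' A"
    using LIMSEQ_unique[OF lim[OF \<mu>] lim[OF \<mu>']]
    by (simp add: \<mu>.emeasure_eq_measure \<mu>'.emeasure_eq_measure)
qed

end

text \<open>Expanding \<open>p = c + (p - c)\<close> along the last visit to the regeneration measure gives the
  invariant density as a geometric series.\<close>

lemma invariant_density_exists:
  fixes lam :: "'b measure" and p :: "'b \<Rightarrow> 'b \<Rightarrow> real"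
  assumes lam: "prob_space lam"
    and p_meas: "(\<lambda>(x, y). p x y) \<in> borel_measurable (lam \<Otimes>\<^sub>M lam)"
    and c: "0 < c" and p_ge: "\<And>x y. c \<le> p x y"
    and p_int: "\<And>x. x \<in> space lam \<Longrightarrow> (\<integral>\<^sup>+y. ennreal (p x y) \<partial>lam) = 1"
  obtains q where "q \<in> borel_measurable lam" "(\<integral>\<^sup>+x. q x \<partial>lam) = 1"
    "\<And>y. y \<in> space lam \<Longrightarrow> (\<integral>\<^sup>+x. q x * ennreal (p x y) \<partial>lam) = q y"
proof -
  interpret prob_space lam by fact
  interpret pair: pair_prob_space lam lam ..
  have pm[measurable]: "(\<lambda>z. p (fst z) (snd z)) \<in> borel_measurable (lam \<Otimes>\<^sub>M lam)"
    using p_meas by (simp add: case_prod_unfold)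
  have pmx[measurable]: "p x \<in> borel_measurable lam" if "x \<in> space lam" for x
    using measurable_compose[OF measurable_Pair1'[OF that] pm] by simp
  have pmy[measurable]: "(\<lambda>x. p x y) \<in> borel_measurable lam" if "y \<in> space lam" for y
    using measurable_compose[OF measurable_Pair2'[OF that] pm] by simp
  have [measurable]: "(\<lambda>z. p (snd z) (fst z)) \<in> borel_measurable (lam \<Otimes>\<^sub>M lam)"
    using measurable_compose[OF _ pm, of "\<lambda>z. (snd z, fst z)"] by simp
  \<comment> \<open>\<open>R\<close> moves densities by the residual kernel \<open>p - c\<close>,
    whose total mass is \<open>1 - c\<close> from every point. Thus \<open>qq k\<close> has mass
    \<open>(1 - c) ^ k\<close>.\<close>
  define R where "R = (\<lambda>g y. \<integral>\<^sup>+x. g x * ennreal (p x y - c) \<partial>lam)"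
  define qq where "qq k = (R ^^ k) (\<lambda>_. 1)" for k
  have Rm: "R g \<in> borel_measurable lam" if [measurable]: "g \<in> borel_measurable lam" for g
    unfolding R_def by measurable
  have qqm[measurable]: "qq k \<in> borel_measurable lam" for k
    unfolding qq_def by (induction k) (auto intro: Rm)
  obtain x0 where x0: "x0 \<in> space lam" using prob_space.not_empty[OF lam] by auto
  have "ennreal c = (\<integral>\<^sup>+y. ennreal c \<partial>lam)" by (simp add: emeasure_space_1)
  also have "\<dots> \<le> (\<integral>\<^sup>+y. ennreal (p x0 y) \<partial>lam)" by (intro nn_integral_mono ennreal_leI p_ge)
  finally have c1: "c \<le> 1" using c p_int[OF x0] by simp
  have pc: "(\<integral>\<^sup>+y. ennreal (p x y - c) \<partial>lam) = ennreal (1 - c)" if x: "x \<in> space lam" for x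
  proof -
    have "(\<integral>\<^sup>+y. ennreal (p x y - c) \<partial>lam) = (\<integral>\<^sup>+y. ennreal (p x y) - ennreal c \<partial>lam)"
      using c by (simp add: ennreal_minus)
    also have "\<dots> = (\<integral>\<^sup>+y. ennreal (p x y) \<partial>lam) - (\<integral>\<^sup>+y. ennreal c \<partial>lam)"
      using x p_ge by (intro nn_integral_diff) (auto simp: emeasure_space_1 intro!: ennreal_leI)
    finally show ?thesis using p_int[OF x] c ennreal_minus[of c 1] by (simp add: emeasure_space_1)
  qed
  have Rint: "(\<integral>\<^sup>+y. R g y \<partial>lam) = ennreal (1 - c) * (\<integral>\<^sup>+x. g x \<partial>lam)"
    if [measurable]: "g \<in> borel_measurable lam" for g
  proof -
    have "(\<integral>\<^sup>+y. R g y \<partial>lam) = (\<integral>\<^sup>+x. \<integral>\<^sup>+y. g x * ennreal (p x y - c) \<partial>lam \<partial>lam)"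
      unfolding R_def by (rule pair.Fubini') measurable
    also have "\<dots> = (\<integral>\<^sup>+x. ennreal (1 - c) * g x \<partial>lam)"
      by (intro nn_integral_cong) (simp add: nn_integral_cmult pc mult.commute)
    finally show ?thesis by (simp add: nn_integral_cmult)
  qed
  have qqint: "(\<integral>\<^sup>+x. qq k x \<partial>lam) = ennreal ((1 - c) ^ k)" for k
  proof (induction k)
    case 0 show ?case by (simp add: qq_def emeasure_space_1)
  next
    case (Suc k)
    have "qq (Suc k) = R (qq k)" by (simp add: qq_def)
    then show ?case using Suc Rint[OF qqm, of k] c1 by (simp add: ennreal_mult)
  qed
  \<comment> \<open>The factor \<open>c\<close> normalizes: the masses sum to \<open>1 / c\<close>.
    The weights \<open>c * (1 - c) ^ k\<close> are the geometric law of the time since the last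
    regeneration.\<close>
  define q where "q y = ennreal c * (\<Sum>k. qq k y)" for y
  have [measurable]: "q \<in> borel_measurable lam" unfolding q_def by measurable
  have geo: "(\<Sum>k. ennreal ((1 - c) ^ k)) = ennreal (1 / c)"
    using c c1 by (subst suminf_ennreal2) (auto simp: summable_geometric suminf_geometric)
  have q1: "(\<integral>\<^sup>+x. q x \<partial>lam) = 1"
    using c by (simp add: q_def nn_integral_cmult nn_integral_suminf qqint geo flip: ennreal_mult)
  have "(\<integral>\<^sup>+x. q x * ennreal (p x y) \<partial>lam) = q y" if y: "y \<in> space lam" for y
  proof -
    have "(\<integral>\<^sup>+x. q x * ennreal (p x y) \<partial>lam) = (\<integral>\<^sup>+x. q x * ennreal (p x y - c) + ennreal c * q x \<partial>lam)"
    proof (intro nn_integral_cong)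
      fix x
      have "ennreal (p x y) = ennreal (p x y - c) + ennreal c"
        using p_ge[of x y] c by (subst ennreal_plus[symmetric]) auto
      then show "q x * ennreal (p x y) = q x * ennreal (p x y - c) + ennreal c * q x"
        by (simp add: distrib_left mult.commute)
    qed
    \<comment> \<open>As \<open>q\<close> has mass 1, the constant part of \<open>p\<close>
      contributes exactly \<open>c\<close>. This is the term \<open>k = 0\<close> of the series for
      \<open>q y\<close>, while \<open>R\<close> shifts all other terms by one.\<close>
    also have "\<dots> = (\<integral>\<^sup>+x. q x * ennreal (p x y - c) \<partial>lam) + ennreal c"
      using y by (simp add: nn_integral_add nn_integral_cmult q1)
    also have "(\<integral>\<^sup>+x. q x * ennreal (p x y - c) \<partial>lam)
        = (\<integral>\<^sup>+x. ennreal c * (\<Sum>k. qq k x * ennreal (p x y - c)) \<partial>lam)"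
      by (simp add: q_def mult.assoc)
    also have "\<dots> = ennreal c * (\<integral>\<^sup>+x. (\<Sum>k. qq k x * ennreal (p x y - c)) \<partial>lam)"
      using y by (intro nn_integral_cmult) measurable
    also have "(\<integral>\<^sup>+x. (\<Sum>k. qq k x * ennreal (p x y - c)) \<partial>lam) = (\<Sum>k. \<integral>\<^sup>+x. qq k x * ennreal (p x y - c) \<partial>lam)"
      using y by (intro nn_integral_suminf) measurable
    also have "\<dots> = (\<Sum>k. qq (Suc k) y)"
      by (simp add: qq_def R_def)
    also have "ennreal c * (\<Sum>k. qq (Suc k) y) + ennreal c = ennreal c * (qq 0 y + (\<Sum>k. qq (Suc k) y))"
      by (simp add: qq_def distrib_left add.commute)
    also have "qq 0 y + (\<Sum>k. qq (Suc k) y) = (\<Sum>k. qq k y)"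
      using suminf_offset[of "\<lambda>k. qq k y" 1] by simp
    finally show ?thesis by (simp add: q_def)
  qed
  then show thesis using that[of q] q1 by simp
qed

section \<open>The chain of states and holding times\<close>

lemma prob_space_holding_law: "0 \<le> c \<Longrightarrow> prob_space (holding_law c)"
  using prob_space_exponential_density[of c] unfolding holding_law_def
  by (auto intro!: prob_space.prob_space_distr prob_space_return)

lemma sets_holding_law[measurable_cong, simp]: "sets (holding_law c) = sets borel"
  by (simp add: holding_law_def)

lemma nn_integral_holding_law:
  assumes "0 \<le> c" shows "(\<integral>\<^sup>+s. s \<partial>holding_law c) = 1 / ennreal c"
proof (cases "c = 0")
  case True
  then show ?thesis by (simp add: holding_law_def nn_integral_return)
next
  case False
  then have c: "0 < c" using assms by simp
  have "(\<integral>\<^sup>+s. s \<partial>holding_law c) = (\<integral>\<^sup>+s. ennreal (exponential_density c s) * ennreal s \<partial>lborel)"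
    using False by (simp add: holding_law_def nn_integral_distr nn_integral_density)
  also have "\<dots> = (\<integral>\<^sup>+s. ennreal (exponential_density c s * s ^ 1) \<partial>lborel)"
    using c by (intro nn_integral_cong) (auto simp: exponential_density_def ennreal_mult' simp flip: ennreal_mult)
  also have "\<dots> = ennreal (fact (0 + 1) / (fact 0 * c ^ 1))"
    by (rule nn_integral_erlang_ith_moment[OF c])
  finally show ?thesis using c divide_ennreal[of 1 c] by simp
qed

context jump_kernel begin

lemma measurable_holding[measurable]:
  "(\<lambda>y. holding_law (r y)) \<in> borel \<rightarrow>\<^sub>M prob_algebra borel"
  by (rule holding_law_measurable[OF r nn])

lemma measurable_holding_pair:
  "(\<lambda>y. distr (holding_law (r y)) (borel \<Otimes>\<^sub>M borel) (Pair y)) \<in> borel \<rightarrow>\<^sub>M prob_algebra (borel \<Otimes>\<^sub>M borel)"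
  by measurable

lemma nn_integral_with_holding:
  assumes \<mu>: "sets \<mu> = sets borel" and g[measurable]: "g \<in> borel_measurable (borel \<Otimes>\<^sub>M borel)"
  shows "(\<integral>\<^sup>+z. g z \<partial>with_holding r \<mu>) = (\<integral>\<^sup>+y. \<integral>\<^sup>+s. g (y, s) \<partial>holding_law (r y) \<partial>\<mu>)"
proof -
  have [measurable]: "(\<lambda>y. distr (holding_law (r y)) (borel \<Otimes>\<^sub>M borel) (Pair y))
      \<in> \<mu> \<rightarrow>\<^sub>M subprob_algebra (borel \<Otimes>\<^sub>M borel)"
    using measurable_prob_algebraD[OF measurable_holding_pair]
    by (simp add: measurable_cong_sets[OF \<mu> refl])
  have "(\<integral>\<^sup>+z. g z \<partial>with_holding r \<mu>)
      = (\<integral>\<^sup>+y. \<integral>\<^sup>+z. g z \<partial>distr (holding_law (r y)) (borel \<Otimes>\<^sub>M borel) (Pair y) \<partial>\<mu>)"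
    unfolding with_holding_def by (rule nn_integral_bind[OF g]) measurable
  also have "\<dots> = (\<integral>\<^sup>+y. \<integral>\<^sup>+s. g (y, s) \<partial>holding_law (r y) \<partial>\<mu>)"
    by (intro nn_integral_cong nn_integral_distr) measurable
  finally show ?thesis .
qed

lemma with_holding_prob_algebra:
  assumes "prob_space \<mu>" "sets \<mu> = sets borel"
  shows "with_holding r \<mu> \<in> space (prob_algebra (borel \<Otimes>\<^sub>M borel))"
proof -
  have "(\<lambda>_. \<mu>) \<in> count_space UNIV \<rightarrow>\<^sub>M prob_algebra borel"
    using assms by (auto simp: space_prob_algebra)
  from measurable_space[OF with_holding_measurable[OF r nn this]] show ?thesis by simp
qed

lemma
  assumes "prob_space \<mu>" "sets \<mu> = sets borel"
  shows prob_space_with_holding: "prob_space (with_holding r \<mu>)"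
    and sets_with_holding: "sets (with_holding r \<mu>) = sets (borel \<Otimes>\<^sub>M borel)"
  using with_holding_prob_algebra[OF assms] by (auto simp: space_prob_algebra)

text \<open>The current holding time is ignored. It is kept in the state only so that functions of
  state and holding time become functions of a Markov chain.\<close>

definition pair_kernel :: "'a \<times> ennreal \<Rightarrow> ('a \<times> ennreal) measure" where
  "pair_kernel z = with_holding r (K (fst z))"

lemma prob_K: "prob_space (K x)" and sets_K: "sets (K x) = sets borel"
  using measurable_space[OF K, of x] by (auto simp: space_prob_algebra)

lemma measurable_pair_kernel[measurable]:
  "pair_kernel \<in> borel \<Otimes>\<^sub>M borel \<rightarrow>\<^sub>M prob_algebra (borel \<Otimes>\<^sub>M borel)"
  unfolding pair_kernel_def[abs_def] by (rule with_holding_measurable[OF r nn]) measurable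

lemma prob_pair_kernel: "prob_space (pair_kernel z)"
  and sets_pair_kernel: "sets (pair_kernel z) = sets (borel \<Otimes>\<^sub>M borel)"
  unfolding pair_kernel_def
  by (auto intro!: prob_space_with_holding sets_with_holding prob_K sets_K)

text \<open>The next pair depends on the state alone, so attaching holding times commutes with one
  step of the chain. This lifts an invariant law of \<open>K\<close> to one of
  \<open>pair_kernel\<close>.\<close>

lemma with_holding_bind_pair_kernel:
  assumes \<mu>: "prob_space \<mu>" "sets \<mu> = sets borel"
  shows "with_holding r \<mu> \<bind> pair_kernel = with_holding r (\<mu> \<bind> K)"
proof -
  have 1: "(\<lambda>y. distr (holding_law (r y)) (borel \<Otimes>\<^sub>M borel) (Pair y))
      \<in> \<mu> \<rightarrow>\<^sub>M subprob_algebra (borel \<Otimes>\<^sub>M borel)"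
    using measurable_prob_algebraD[OF measurable_holding_pair]
    by (simp add: measurable_cong_sets[OF \<mu>(2) refl])
  have 2: "K \<in> \<mu> \<rightarrow>\<^sub>M subprob_algebra borel"
    using measurable_prob_algebraD[OF K] by (simp add: measurable_cong_sets[OF \<mu>(2) refl])
  have 3: "distr (holding_law (r y)) (borel \<Otimes>\<^sub>M borel) (Pair y) \<bind> pair_kernel = with_holding r (K y)" for y
  proof -
    have "distr (holding_law (r y)) (borel \<Otimes>\<^sub>M borel) (Pair y) \<bind> pair_kernel
        = holding_law (r y) \<bind> (\<lambda>s. pair_kernel (y, s))"
      using prob_space.not_empty[OF prob_space_holding_law[OF nn, of y]]
      by (intro bind_distr[where K="borel \<Otimes>\<^sub>M borel"] measurable_prob_algebraD) auto
    also have "\<dots> = holding_law (r y) \<bind> (\<lambda>s. with_holding r (K y))"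
      by (simp add: pair_kernel_def)
    also have "\<dots> = with_holding r (K y)"
      by (intro bind_const' prob_space_holding_law nn prob_space_imp_subprob_space
          prob_space_with_holding prob_K sets_K)
    finally show ?thesis .
  qed
  have "with_holding r \<mu> \<bind> pair_kernel
      = \<mu> \<bind> (\<lambda>y. distr (holding_law (r y)) (borel \<Otimes>\<^sub>M borel) (Pair y) \<bind> pair_kernel)"
    unfolding with_holding_def
    by (rule bind_assoc[OF 1 measurable_prob_algebraD[OF measurable_pair_kernel]])
  also have "\<dots> = \<mu> \<bind> (\<lambda>y. with_holding r (K y))" by (simp add: 3)
  also have "\<dots> = with_holding r (\<mu> \<bind> K)"
    unfolding with_holding_def
    by (rule bind_assoc[symmetric, OF 2 measurable_prob_algebraD[OF measurable_holding_pair]])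
  finally show ?thesis .
qed

section \<open>Finite-dimensional marginals and the Markov property of the skeleton\<close>

lemma space_skeleton_law: "space (skeleton_law r K x) = UNIV"
  using sets_eq_imp_space_eq[OF sets_skeleton_law[of x]] by (simp add: space_PiM space_pair_measure)

declare sets_skeleton_law[measurable_cong]

lemma measurable_skeleton_restrict[measurable]:
  "(\<lambda>w. restrict w {0..<n}) \<in> skeleton_law r K x \<rightarrow>\<^sub>M PiM {0..<n} M"
  by (auto intro!: measurable_restrict)

text \<open>The Ionescu-Tulcea composition of the first \<open>n\<close> steps. It starts from the
  only element of the empty product, the everywhere \<open>undefined\<close> function.\<close>

abbreviation "initial_law x n \<equiv> IT.C x 0 n (\<lambda>_. undefined)"

lemma sets_initial_law[measurable_cong]: "sets (initial_law x n) = sets (PiM {0..<n} M)"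
  by (subst IT.sets_C) (auto simp: space_PiM)

lemma space_initial_law: "space (initial_law x n) = space (PiM {0..<n} M)"
  by (rule sets_eq_imp_space_eq[OF sets_initial_law])

lemma measurable_eP_initial: "IT.eP x n \<in> initial_law x n \<rightarrow>\<^sub>M subprob_algebra (PiM {0..<Suc n} M)"
  using IT.measurable_eP by (simp add: measurable_cong_sets[OF sets_initial_law refl])

lemma measurable_component_less:
  assumes "h \<in> borel_measurable (borel \<Otimes>\<^sub>M borel)" "i < n"
  shows "(\<lambda>w. h (w i)) \<in> borel_measurable (PiM {0..<n} M)"
  using assms by (intro measurable_compose[OF measurable_component_singleton[of i "{0..<n}" M]]) auto

lemma distr_skeleton_restrict:
  "distr (skeleton_law r K x) (PiM {0..<n} M) (\<lambda>w. restrict w {0..<n}) = initial_law x n"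
proof -
  have "IT.up_to {0..<n} = n"
    using IT.up_to_iff_Ico[of "{0..<n}" n] IT.up_to[of "{0..<n}"] by (intro antisym) auto
  then show ?thesis
    using IT.distr_C[of n n "\<lambda>_. undefined" 0 x]
    by (simp add: skeleton_law_eq IT.distr_lim IT.CI_def space_PiM)
qed

text \<open>Conditioning on the first \<open>n\<close> coordinates. The kernel
  \<open>step x n\<close> is left in place so that one formula covers the initial draw,
  \<open>n = 0\<close>, and the later transitions.\<close>

lemma nn_integral_skeleton_component:
  assumes [measurable]: "g \<in> borel_measurable (borel \<Otimes>\<^sub>M borel)"
  shows "(\<integral>\<^sup>+w. g (w n) \<partial>skeleton_law r K x)
     = (\<integral>\<^sup>+w. \<integral>\<^sup>+z. g z \<partial>step x n w \<partial>skeleton_law r K x)"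
proof -
  have "(\<integral>\<^sup>+w. g (w n) \<partial>skeleton_law r K x) = (\<integral>\<^sup>+w. g (w n) \<partial>initial_law x (Suc n))"
    by (subst distr_skeleton_restrict[symmetric], subst nn_integral_distr) auto
  also have "\<dots> = (\<integral>\<^sup>+w. \<integral>\<^sup>+w'. g (w' n) \<partial>IT.eP x n w \<partial>initial_law x n)"
    using nn_integral_bind[OF _ measurable_eP_initial, of "\<lambda>w. g (w n)" n x]
    by (simp add: measurable_component_less)
  also have "\<dots> = (\<integral>\<^sup>+w. \<integral>\<^sup>+z. g z \<partial>step x n w \<partial>initial_law x n)"
  proof (rule nn_integral_cong)
    fix w assume "w \<in> space (initial_law x n)"
    then have "w \<in> space (PiM {0..<n} M)" by (simp only: space_initial_law)
    then show "(\<integral>\<^sup>+w'. g (w' n) \<partial>IT.eP x n w) = (\<integral>\<^sup>+z. g z \<partial>step x n w)"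
      by (subst IT.nn_integral_eP) auto
  qed
  also have "\<dots> = (\<integral>\<^sup>+w. \<integral>\<^sup>+z. g z \<partial>step x n (restrict w {0..<n}) \<partial>skeleton_law r K x)"
  proof -
    have "step x n \<in> PiM {0..<n} M \<rightarrow>\<^sub>M subprob_algebra (borel \<Otimes>\<^sub>M borel)" by (rule IT.P)
    then have "(\<lambda>w. \<integral>\<^sup>+z. g z \<partial>step x n w) \<in> borel_measurable (PiM {0..<n} M)"
      by (rule measurable_compose[OF _ nn_integral_measurable_subprob_algebra]) measurable
    then show ?thesis
      using nn_integral_distr[OF measurable_skeleton_restrict[of n x], of "\<lambda>w. \<integral>\<^sup>+z. g z \<partial>step x n w"]
      by (simp add: distr_skeleton_restrict)
  qed
  also have "\<dots> = (\<integral>\<^sup>+w. \<integral>\<^sup>+z. g z \<partial>step x n w \<partial>skeleton_law r K x)"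
    by (cases n) auto
  finally show ?thesis .
qed

text \<open>The Markov property, tested against bounded functions \<open>A\<close> of the past. This
  form is just what the orthogonality of martingale increments requires.\<close>

lemma skeleton_markov:
  fixes A :: "(nat \<Rightarrow> 'a \<times> ennreal) \<Rightarrow> real"
  assumes [measurable]: "A \<in> borel_measurable (PiM {0..<Suc n} M)" "u \<in> borel_measurable (borel \<Otimes>\<^sub>M borel)"
    and A: "\<And>w. \<bar>A w\<bar> \<le> a" and u: "\<And>z. \<bar>u z\<bar> \<le> U"
  shows "(\<integral>w. A (restrict w {0..<Suc n}) * u (w (Suc n)) \<partial>skeleton_law r K x)
     = (\<integral>w. A (restrict w {0..<Suc n}) * (\<integral>z. u z \<partial>pair_kernel (w n)) \<partial>skeleton_law r K x)"
proof -
  have um: "(\<lambda>z. \<integral>y. u y \<partial>pair_kernel z) \<in> borel_measurable (borel \<Otimes>\<^sub>M borel)"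
    by (rule measurable_compose[OF measurable_prob_algebraD[OF measurable_pair_kernel]
        integral_measurable_subprob_algebra]) measurable
  \<comment> \<open>The explicit restriction lets one formula serve on the infinite product and on
    the finite ones.\<close>
  let ?F = "\<lambda>w. A (restrict w {0..<Suc n}) * u (w (Suc n))"
  have [measurable]: "?F \<in> borel_measurable (PiM {0..<Suc (Suc n)} M)"
    by (auto intro!: borel_measurable_times measurable_compose[OF _ assms(1)]
        measurable_component_less[OF assms(2)] measurable_restrict_subset)
  have rr: "restrict (restrict w {0..<Suc (Suc n)}) {0..<Suc n} = restrict w {0..<Suc n}" for w :: "nat \<Rightarrow> 'a \<times> ennreal"
    by (auto simp: restrict_def fun_eq_iff)
  have "(\<integral>w. ?F w \<partial>skeleton_law r K x) = (\<integral>w. ?F w \<partial>initial_law x (Suc (Suc n)))"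
    by (subst distr_skeleton_restrict[symmetric], subst integral_distr) (auto simp: rr)
  also have "\<dots> = (\<integral>w. \<integral>w'. ?F w' \<partial>IT.eP x (Suc n) w \<partial>initial_law x (Suc n))"
  proof -
    have ps: "prob_space (initial_law x (Suc n))" by (rule IT.prob_space_C) (simp add: space_PiM)
    have "\<bar>?F w\<bar> \<le> a * U" for w
      unfolding abs_mult by (intro mult_mono A u) (auto intro: order_trans[OF abs_ge_zero A])
    then have "(\<integral>w. ?F w \<partial>(initial_law x (Suc n) \<bind> IT.eP x (Suc n)))
        = (\<integral>w. \<integral>w'. ?F w' \<partial>IT.eP x (Suc n) w \<partial>initial_law x (Suc n))"
      using ps IT.prob_space_eP[of _ "Suc n" x]
      by (intro integral_bind[where K="PiM {0..<Suc (Suc n)} M" and B="a * U" and B'=1])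
         (auto simp: measurable_eP_initial space_initial_law prob_space.emeasure_space_1 simp del: IT.C.simps intro!: AE_I2 prob_space.finite_measure)
    then show ?thesis by simp
  qed
  also have "\<dots> = (\<integral>w. A w * (\<integral>z. u z \<partial>pair_kernel (w n)) \<partial>initial_law x (Suc n))"
  proof (rule Bochner_Integration.integral_cong[OF refl])
    fix w assume "w \<in> space (initial_law x (Suc n))"
    then have w: "w \<in> space (PiM {0..<Suc n} M)" by (simp only: space_initial_law)
    \<comment> \<open>Elements of the finite product are extensional, so restricting removes the
      value added at \<open>Suc n\<close> and gives back \<open>w\<close>.\<close>
    then have rw: "restrict (w(Suc n := z)) {0..<Suc n} = w" for z
      by (auto simp: space_PiM PiE_iff extensional_def restrict_def fun_eq_iff)
    have "(\<integral>w'. ?F w' \<partial>IT.eP x (Suc n) w) = (\<integral>z. ?F (w(Suc n := z)) \<partial>step x (Suc n) w)"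
      unfolding IT.eP_def using w
      by (intro integral_distr measurable_fun_upd[where J="{0..<Suc n}"])
         (auto simp: measurable_cong_sets[OF sets_pair_kernel refl] pair_kernel_def[symmetric] space_PiM)
    also have "\<dots> = A w * (\<integral>z. u z \<partial>pair_kernel (w n))"
      by (simp add: rw pair_kernel_def)
    finally show "(\<integral>w'. ?F w' \<partial>IT.eP x (Suc n) w) = A w * (\<integral>z. u z \<partial>pair_kernel (w n))" .
  qed
  also have "\<dots> = (\<integral>w. A (restrict w {0..<Suc n}) * (\<integral>z. u z \<partial>pair_kernel (w n)) \<partial>skeleton_law r K x)"
    by (subst distr_skeleton_restrict[symmetric], subst integral_distr)
       (auto intro!: borel_measurable_times measurable_component_less[OF um])
  finally show ?thesis .
qed

end

section \<open>Weak law of large numbers\<close>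

context jump_kernel begin

lemma measurable_pair_kernel_integral:
  "u \<in> borel_measurable (borel \<Otimes>\<^sub>M borel) \<Longrightarrow>
    (\<lambda>z. \<integral>y. u y \<partial>pair_kernel z :: real) \<in> borel_measurable (borel \<Otimes>\<^sub>M borel)"
  by (rule measurable_compose[OF measurable_prob_algebraD[OF measurable_pair_kernel]
      integral_measurable_subprob_algebra])

lemma pair_kernel_integral_bound:
  fixes u :: "'a \<times> ennreal \<Rightarrow> real"
  assumes um: "u \<in> borel_measurable (borel \<Otimes>\<^sub>M borel)" and u: "\<And>z. \<bar>u z\<bar> \<le> U"
  shows "\<bar>\<integral>y. u y \<partial>pair_kernel z\<bar> \<le> U"
proof -
  interpret Q: prob_space "pair_kernel z" by (rule prob_pair_kernel)
  have "integrable (pair_kernel z) u"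
    by (rule Q.integrable_const_bound[where B=U])
      (use um u in \<open>auto simp: measurable_cong_sets[OF sets_pair_kernel refl]\<close>)
  moreover have "- U \<le> u z" "u z \<le> U" for z using u[of z] by auto
  ultimately have "- U \<le> (\<integral>y. u y \<partial>pair_kernel z)" "(\<integral>y. u y \<partial>pair_kernel z) \<le> U"
    by (auto intro!: Q.integral_ge_const Q.integral_le_const)
  then show ?thesis by auto
qed

text \<open>The integrand is the square of a martingale with increments bounded by \<open>2 U\<close>.\<close>

lemma skeleton_martingale_second_moment:
  fixes u :: "'a \<times> ennreal \<Rightarrow> real"
  assumes um[measurable]: "u \<in> borel_measurable (borel \<Otimes>\<^sub>M borel)" and u: "\<And>z. \<bar>u z\<bar> \<le> U"
  defines "v \<equiv> \<lambda>z. \<integral>y. u y \<partial>pair_kernel z"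
  shows "integrable (skeleton_law r K x) (\<lambda>w. ((\<Sum>k\<le>n. u (w k) - v (w k)) + v (w n))\<^sup>2)"
    and "(\<integral>w. ((\<Sum>k\<le>n. u (w k) - v (w k)) + v (w n))\<^sup>2 \<partial>skeleton_law r K x) \<le> 4 * U\<^sup>2 * Suc n"
proof -
  interpret P: prob_space "skeleton_law r K x" by (rule prob_space_skeleton_law)
  have vm[measurable]: "v \<in> borel_measurable (borel \<Otimes>\<^sub>M borel)"
    unfolding v_def by (rule measurable_pair_kernel_integral[OF um])
  have v: "\<bar>v z\<bar> \<le> U" for z
    unfolding v_def by (rule pair_kernel_integral_bound[OF um u])
  have U0: "0 \<le> U" using u abs_ge_zero order_trans by blast
  \<comment> \<open>Regrouped, this is \<open>u (w 0)\<close> plus the increments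
    \<open>u (w (Suc k)) - v (w k)\<close>: the added \<open>v (w n)\<close> cancels the last
    compensator and shifts the others by one index.\<close>
  define D where "D n w = (\<Sum>k\<le>n. u (w k) - v (w k)) + v (w n)" for n and w :: "nat \<Rightarrow> 'a \<times> ennreal"
  have D0: "D 0 w = u (w 0)" for w by (simp add: D_def)
  have DS: "D (Suc n) w = D n w + (u (w (Suc n)) - v (w n))" for n w by (simp add: D_def)
  \<comment> \<open>This crude linear bound serves only for integrability; the sharp order comes
    from orthogonality.\<close>
  have Db: "\<bar>D n w\<bar> \<le> 2 * U * Suc n" for n w
  proof (induction n)
    case 0 show ?case using u[of "w 0"] U0 by (simp add: D0)
  next
    case (Suc n) then show ?case using u[of "w (Suc n)"] v[of "w n"] by (simp add: DS algebra_simps)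
  qed
  have Dr: "D n (restrict w {0..<Suc n}) = D n w" for n w
    by (auto simp: D_def intro!: sum.cong)
  have Dm': "D n \<in> borel_measurable (PiM {0..<Suc n} M)" for n
    unfolding D_def by (intro borel_measurable_add borel_measurable_sum borel_measurable_diff
        measurable_component_less um vm) auto
  have Dm[measurable]: "D n \<in> borel_measurable (skeleton_law r K x)" for n
    using measurable_compose[OF measurable_skeleton_restrict Dm'] by (simp add: Dr)
  have int: "integrable (skeleton_law r K x) f"
    if "f \<in> borel_measurable (skeleton_law r K x)" "\<And>w. \<bar>f w\<bar> \<le> b" for f :: "_ \<Rightarrow> real" and b
    using that by (intro P.integrable_const_bound[where B=b]) auto
  have Db': "\<bar>(D n w)\<^sup>2\<bar> \<le> (2 * U * Suc n)\<^sup>2" for n w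
    using Db[of n w] U0 by (simp add: abs_le_square_iff[symmetric])
  have iD: "integrable (skeleton_law r K x) (\<lambda>w. (D n w)\<^sup>2)" for n
    by (rule int[OF _ Db']) measurable
  then show "integrable (skeleton_law r K x) (\<lambda>w. ((\<Sum>k\<le>n. u (w k) - v (w k)) + v (w n))\<^sup>2)"
    by (simp add: D_def)
  have sq: "(a::real)\<^sup>2 \<le> b\<^sup>2" if "\<bar>a\<bar> \<le> b" for a b
    using that by (intro abs_le_square_iff[THEN iffD1]) auto
  have "(\<integral>w. (D n w)\<^sup>2 \<partial>skeleton_law r K x) \<le> 4 * U\<^sup>2 * Suc n"
  proof (induction n)
    case 0
    have "(\<integral>w. (D 0 w)\<^sup>2 \<partial>skeleton_law r K x) \<le> U\<^sup>2"
      using iD[of 0] sq[OF u] by (intro P.integral_le_const) (auto simp: D0)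
    also have "\<dots> \<le> 4 * U\<^sup>2 * Suc 0" by simp
    finally show ?case .
  next
    case (Suc n)
    let ?I = "\<lambda>w. u (w (Suc n)) - v (w n)"
    have i1: "integrable (skeleton_law r K x) (\<lambda>w. D n w * u (w (Suc n)))"
      by (rule int[of _ "(2 * U * Suc n) * U"])
         (auto simp: abs_mult simp del: of_nat_Suc intro!: mult_mono Db u U0 mult_nonneg_nonneg)
    have i2: "integrable (skeleton_law r K x) (\<lambda>w. D n w * v (w n))"
      by (rule int[of _ "(2 * U * Suc n) * U"])
         (auto simp: abs_mult simp del: of_nat_Suc intro!: mult_mono Db v U0 mult_nonneg_nonneg)
    have Ib: "(?I w)\<^sup>2 \<le> 4 * U\<^sup>2" for w
      using sq[of "?I w" "2 * U"] u[of "w (Suc n)"] v[of "w n"] by (auto simp: power_mult_distrib)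
    have i3: "integrable (skeleton_law r K x) (\<lambda>w. (?I w)\<^sup>2)"
      by (rule int[of _ "4 * U\<^sup>2"]) (use Ib in auto)
    \<comment> \<open>\<open>D n\<close> depends on coordinates up to \<open>n\<close>, and
      \<open>v (w n)\<close> is the conditional mean of \<open>u (w (Suc n))\<close>. The cross term
      of the squared sum therefore vanishes.\<close>
    have orth: "(\<integral>w. D n w * u (w (Suc n)) \<partial>skeleton_law r K x) = (\<integral>w. D n w * v (w n) \<partial>skeleton_law r K x)"
      using skeleton_markov[OF Dm' um Db u, of x] by (simp add: Dr v_def)
    have "(\<lambda>w. (D (Suc n) w)\<^sup>2) = (\<lambda>w. (D n w)\<^sup>2 + 2 * (D n w * u (w (Suc n)) - D n w * v (w n)) + (?I w)\<^sup>2)"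
      by (simp add: DS power2_eq_square algebra_simps)
    then have "(\<integral>w. (D (Suc n) w)\<^sup>2 \<partial>skeleton_law r K x)
       = (\<integral>w. (D n w)\<^sup>2 \<partial>skeleton_law r K x) + (\<integral>w. (?I w)\<^sup>2 \<partial>skeleton_law r K x)"
      using iD i1 i2 i3 orth by simp
    also have "(\<integral>w. (?I w)\<^sup>2 \<partial>skeleton_law r K x) \<le> 4 * U\<^sup>2"
      using i3 Ib by (intro P.integral_le_const) auto
    finally show ?case using Suc by (simp add: algebra_simps)
  qed
  then show "(\<integral>w. ((\<Sum>k\<le>n. u (w k) - v (w k)) + v (w n))\<^sup>2 \<partial>skeleton_law r K x) \<le> 4 * U\<^sup>2 * Suc n"
    by (simp add: D_def)
qed

text \<open>Chebyshev's inequality for the martingale above. The sum differs from it by the single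
  term \<open>v (w (n - 1))\<close>, which the extra \<open>U\<close> in the threshold
  absorbs.\<close>

lemma skeleton_coboundary_tail:
  fixes u :: "'a \<times> ennreal \<Rightarrow> real"
  assumes um[measurable]: "u \<in> borel_measurable (borel \<Otimes>\<^sub>M borel)" and u: "\<And>z. \<bar>u z\<bar> \<le> U"
    and a: "0 < a" and n: "0 < n"
  defines "v \<equiv> \<lambda>z. \<integral>y. u y \<partial>pair_kernel z"
  shows "measure (skeleton_law r K x) {w. n * a + U < \<bar>\<Sum>k<n. u (w k) - v (w k)\<bar>} \<le> 4 * U\<^sup>2 / (n * a\<^sup>2)"
proof -
  interpret P: prob_space "skeleton_law r K x" by (rule prob_space_skeleton_law)
  obtain m where m: "n = Suc m" using n by (cases n) auto
  have [measurable]: "v \<in> borel_measurable (borel \<Otimes>\<^sub>M borel)"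
    unfolding v_def by (rule measurable_pair_kernel_integral[OF um])
  have v: "\<bar>v z\<bar> \<le> U" for z
    unfolding v_def by (rule pair_kernel_integral_bound[OF um u])
  let ?D = "\<lambda>w. (\<Sum>k\<le>m. u (w k) - v (w k)) + v (w m)"
  have na: "0 < n * a" using a n by simp
  have "measure (skeleton_law r K x) {w. n * a + U < \<bar>\<Sum>k<n. u (w k) - v (w k)\<bar>}
      \<le> measure (skeleton_law r K x) {w \<in> space (skeleton_law r K x). n * a \<le> \<bar>?D w\<bar>}"
  proof (rule P.finite_measure_mono)
    show "{w. n * a + U < \<bar>\<Sum>k<n. u (w k) - v (w k)\<bar>} \<subseteq> {w \<in> space (skeleton_law r K x). n * a \<le> \<bar>?D w\<bar>}"
    proof (safe, simp_all add: space_skeleton_law)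
      fix w :: "nat \<Rightarrow> 'a \<times> ennreal"
      assume "n * a + U < \<bar>\<Sum>k<n. u (w k) - v (w k)\<bar>"
      then show "n * a \<le> \<bar>?D w\<bar>" using v[of "w m"] by (auto simp: m lessThan_Suc_atMost)
    qed
  qed measurable
  also have "\<dots> \<le> (\<integral>w. (?D w)\<^sup>2 \<partial>skeleton_law r K x) / (n * a)\<^sup>2"
  proof (rule P.second_moment_method)
    show "integrable (skeleton_law r K x) (\<lambda>w. (?D w)\<^sup>2)"
      unfolding v_def by (rule skeleton_martingale_second_moment(1)[OF um u])
  qed (use na in measurable)
  also have "\<dots> \<le> (4 * U\<^sup>2 * n) / (n * a)\<^sup>2"
    using skeleton_martingale_second_moment(2)[OF um u, of x m] by (intro divide_right_mono) (auto simp: v_def m)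
  also have "\<dots> = 4 * U\<^sup>2 / (n * a\<^sup>2)" using n by (simp add: power2_eq_square field_simps)
  finally show ?thesis .
qed

end

text \<open>The comparison with \<open>lam\<close> goes both ways. The lower bound gives the
  contraction; the upper one carries the integrability of \<open>1 / r\<close> from
  \<open>lam\<close> to every step after the first and to \<open>\<pi>0\<close>. Both are stated for
  integrals, so that they pass to the pair chain once the holding time is integrated out.\<close>

locale ergodic_jump_kernel = jump_kernel +
  fixes lam \<pi>0 :: "'a measure" and c C :: real
  assumes prob_lam: "prob_space lam" and sets_lam: "sets lam = sets borel"
    and c_pos: "0 < c"
    and K_ge: "\<And>x g. g \<in> borel_measurable borel \<Longrightarrow> ennreal c * (\<integral>\<^sup>+y. g y \<partial>lam) \<le> (\<integral>\<^sup>+y. g y \<partial>K x)"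
    and K_le: "\<And>x g. g \<in> borel_measurable borel \<Longrightarrow> (\<integral>\<^sup>+y. g y \<partial>K x) \<le> ennreal C * (\<integral>\<^sup>+y. g y \<partial>lam)"
    and inv_r: "(\<integral>\<^sup>+x. 1 / ennreal (r x) \<partial>lam) < \<infinity>"
    and inv: "invariant_prob K \<pi>0"
begin

text \<open>\<open>\<Lambda>\<close> is the reference measure of the pair chain, and
  \<open>\<Theta>\<close> its stationary law.\<close>

abbreviation "\<Lambda> \<equiv> with_holding r lam"
abbreviation "\<Theta> \<equiv> with_holding r \<pi>0"

lemma prob_\<pi>0: "prob_space \<pi>0" and sets_\<pi>0: "sets \<pi>0 = sets borel" and bind_\<pi>0: "\<pi>0 \<bind> K = \<pi>0"
  using inv by (auto simp: invariant_prob_def)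

lemmas prob_\<Lambda> = prob_space_with_holding[OF prob_lam sets_lam]
lemmas sets_\<Lambda>[measurable_cong] = sets_with_holding[OF prob_lam sets_lam]
lemmas prob_\<Theta> = prob_space_with_holding[OF prob_\<pi>0 sets_\<pi>0]
lemmas sets_\<Theta>[measurable_cong] = sets_with_holding[OF prob_\<pi>0 sets_\<pi>0]

lemma measurable_holding_integral:
  assumes [measurable]: "g \<in> borel_measurable (borel \<Otimes>\<^sub>M borel)"
  shows "(\<lambda>y. \<integral>\<^sup>+s. g (y, s) \<partial>holding_law (r y)) \<in> borel_measurable borel"
  by (rule nn_integral_measurable_subprob_algebra2[OF _ measurable_prob_algebraD[OF measurable_holding]])
    (simp add: case_prod_eta)

lemma pair_kernel_ge:
  assumes "g \<in> borel_measurable (borel \<Otimes>\<^sub>M borel)"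
  shows "ennreal c * (\<integral>\<^sup>+z. g z \<partial>\<Lambda>) \<le> (\<integral>\<^sup>+z. g z \<partial>pair_kernel y)"
  unfolding pair_kernel_def
  using K_ge[OF measurable_holding_integral[OF assms]]
  by (simp add: nn_integral_with_holding sets_lam sets_K assms)

lemma pair_kernel_le:
  assumes "g \<in> borel_measurable (borel \<Otimes>\<^sub>M borel)"
  shows "(\<integral>\<^sup>+z. g z \<partial>pair_kernel y) \<le> ennreal C * (\<integral>\<^sup>+z. g z \<partial>\<Lambda>)"
  unfolding pair_kernel_def
  using K_le[OF measurable_holding_integral[OF assms]]
  by (simp add: nn_integral_with_holding sets_lam sets_K assms)

sublocale pair: doeblin_kernel "borel \<Otimes>\<^sub>M borel" pair_kernel \<Lambda> c
  by (rule doeblin_kernel.intro)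
    (rule measurable_pair_kernel, rule prob_\<Lambda>, rule sets_\<Lambda>, rule c_pos, rule pair_kernel_ge, assumption)

lemma \<Theta>_invariant: "\<Theta> \<bind> pair_kernel = \<Theta>"
  by (simp add: with_holding_bind_pair_kernel[OF prob_\<pi>0 sets_\<pi>0] bind_\<pi>0)

text \<open>One step of the chain preserves \<open>\<Theta>\<close>, and every transition law is at
  most \<open>C\<close> times \<open>\<Lambda>\<close>.\<close>

lemma \<Theta>_le:
  assumes g: "g \<in> borel_measurable (borel \<Otimes>\<^sub>M borel)"
  shows "(\<integral>\<^sup>+z. g z \<partial>\<Theta>) \<le> ennreal C * (\<integral>\<^sup>+z. g z \<partial>\<Lambda>)"
proof -
  interpret \<Theta>: prob_space \<Theta> by (rule prob_\<Theta>)
  have "pair_kernel \<in> \<Theta> \<rightarrow>\<^sub>M subprob_algebra (borel \<Otimes>\<^sub>M borel)"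
    using measurable_prob_algebraD[OF measurable_pair_kernel] by (simp add: measurable_cong_sets[OF sets_\<Theta> refl])
  from nn_integral_bind[OF g this] have "(\<integral>\<^sup>+z. g z \<partial>\<Theta>) = (\<integral>\<^sup>+y. \<integral>\<^sup>+z. g z \<partial>pair_kernel y \<partial>\<Theta>)"
    by (simp add: \<Theta>_invariant)
  also have "\<dots> \<le> (\<integral>\<^sup>+y. ennreal C * (\<integral>\<^sup>+z. g z \<partial>\<Lambda>) \<partial>\<Theta>)"
    by (intro nn_integral_mono pair_kernel_le g)
  finally show ?thesis by (simp add: \<Theta>.emeasure_space_1)
qed

lemma wlln_bounded:
  fixes \<phi> :: "'a \<times> ennreal \<Rightarrow> real"
  assumes \<phi>m[measurable]: "\<phi> \<in> borel_measurable (borel \<Otimes>\<^sub>M borel)" and \<phi>: "\<And>z. \<bar>\<phi> z\<bar> \<le> b"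
    and \<epsilon>: "0 < \<epsilon>" and \<eta>: "0 < \<eta>"
  shows "\<exists>n0. \<forall>n\<ge>n0. \<forall>x. measure (skeleton_law r K x)
    {w. n * \<epsilon> < \<bar>(\<Sum>k<n. \<phi> (w k)) - n * (\<integral>z. \<phi> z \<partial>\<Theta>)\<bar>} \<le> \<eta>"
proof -
  have sp: "z \<in> space (borel \<Otimes>\<^sub>M borel)" for z :: "'a \<times> ennreal" by (simp add: space_pair_measure)
  let ?m = "\<integral>z. \<phi> z \<partial>\<Theta>"
  have b0: "0 \<le> b" using \<phi> abs_ge_zero order_trans by blast
  obtain N where N: "(1 - c) ^ N * (2 * b) < \<epsilon> / 3"
    using order_tendstoD(2)[OF pair.power_contraction_tendsto_0[OF sp], of "\<epsilon> / 3" "2 * b"] \<epsilon>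
    unfolding eventually_sequentially by auto
  \<comment> \<open>The truncated Neumann series for Poisson's equation. By telescoping,
    \<open>u - v\<close> is \<open>\<phi>\<close> minus its iterate of order \<open>N\<close>, and
    the choice of \<open>N\<close> puts that iterate within \<open>\<epsilon> / 3\<close> of the
    stationary mean.\<close>
  define u where "u z = (\<Sum>j<N. (pair.op ^^ j) \<phi> z)" for z
  have itm[measurable]: "(pair.op ^^ j) \<phi> \<in> borel_measurable (borel \<Otimes>\<^sub>M borel)" for j
    by (rule pair.iterate_measurable[OF \<phi>m])
  have itb: "\<bar>(pair.op ^^ j) \<phi> z\<bar> \<le> b" for j z
  proof -
    have "- b \<le> \<phi> z" "\<phi> z \<le> b" for z using \<phi>[of z] by auto
    from pair.iterate_bounds[OF \<phi>m this sp] show ?thesis by (simp add: abs_le_iff) (smt (verit))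
  qed
  have um[measurable]: "u \<in> borel_measurable (borel \<Otimes>\<^sub>M borel)" unfolding u_def by measurable
  have ub: "\<bar>u z\<bar> \<le> N * b" for z
    unfolding u_def
    using order_trans[OF sum_abs sum_mono[of "{..<N}" "\<lambda>j. \<bar>(pair.op ^^ j) \<phi> z\<bar>" "\<lambda>_. b"]] itb
    by simp
  define v where "v z = (\<integral>y. u y \<partial>pair_kernel z)" for z
  have uv: "u z - v z = \<phi> z - (pair.op ^^ N) \<phi> z" for z
  proof -
    have "- b \<le> (pair.op ^^ j) \<phi> y" "(pair.op ^^ j) \<phi> y \<le> b" for j y using itb[of j y] by auto
    then have "integrable (pair_kernel z) ((pair.op ^^ j) \<phi>)" for j
      by (rule pair.integrable_bounded[OF prob_pair_kernel sets_pair_kernel itm])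
    then have "v z = (\<Sum>j<N. (pair.op ^^ Suc j) \<phi> z)"
      by (simp add: v_def u_def pair.op_def[abs_def])
    then have "u z - v z = (\<Sum>j<N. (pair.op ^^ j) \<phi> z - (pair.op ^^ Suc j) \<phi> z)"
      by (simp add: u_def sum_subtractf)
    also have "\<dots> = (pair.op ^^ 0) \<phi> z - (pair.op ^^ N) \<phi> z" by (rule sum_lessThan_telescope')
    finally show ?thesis by simp
  qed
  have close: "\<bar>(\<phi> z - ?m) - (u z - v z)\<bar> \<le> \<epsilon> / 3" for z
    using pair.iterate_convergence[OF prob_\<Theta> sets_\<Theta> \<Theta>_invariant \<phi>m \<phi> sp, of N z] N uv[of z] by simp
  define U where "U = N * b"
  have U0: "0 \<le> U" using b0 by (simp add: U_def)
  \<comment> \<open>The first entry makes the boundary term \<open>U\<close> at most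
    \<open>n * (\<epsilon> / 3)\<close>. The second makes the Chebyshev bound with threshold
    \<open>\<epsilon> / 3\<close> at most \<open>\<eta>\<close>, the 36 being \<open>4 * 9\<close>.
    Neither involves \<open>x\<close>.\<close>
  define n0 where "n0 = Suc (nat \<lceil>max (3 * U / \<epsilon>) (36 * U\<^sup>2 / (\<eta> * \<epsilon>\<^sup>2))\<rceil>)"
  have "measure (skeleton_law r K x) {w. n * \<epsilon> < \<bar>(\<Sum>k<n. \<phi> (w k)) - n * ?m\<bar>} \<le> \<eta>" if n: "n0 \<le> n" for n x
  proof -
    interpret P: prob_space "skeleton_law r K x" by (rule prob_space_skeleton_law)
    have n1: "0 < n" "3 * U / \<epsilon> \<le> n" "36 * U\<^sup>2 / (\<eta> * \<epsilon>\<^sup>2) \<le> n"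
      using n unfolding n0_def by linarith+
    have "measure (skeleton_law r K x) {w. n * \<epsilon> < \<bar>(\<Sum>k<n. \<phi> (w k)) - n * ?m\<bar>}
       \<le> measure (skeleton_law r K x) {w. n * (\<epsilon> / 3) + U < \<bar>\<Sum>k<n. u (w k) - v (w k)\<bar>}"
    proof (rule P.finite_measure_mono)
      show "{w. n * \<epsilon> < \<bar>(\<Sum>k<n. \<phi> (w k)) - n * ?m\<bar>} \<subseteq> {w. n * (\<epsilon> / 3) + U < \<bar>\<Sum>k<n. u (w k) - v (w k)\<bar>}"
      proof safe
        fix w :: "nat \<Rightarrow> 'a \<times> ennreal"
        assume *: "n * \<epsilon> < \<bar>(\<Sum>k<n. \<phi> (w k)) - n * ?m\<bar>"
        have "\<bar>((\<Sum>k<n. \<phi> (w k)) - n * ?m) - (\<Sum>k<n. u (w k) - v (w k))\<bar>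
            = \<bar>\<Sum>k<n. (\<phi> (w k) - ?m) - (u (w k) - v (w k))\<bar>"
          by (simp add: sum_subtractf)
        also have "\<dots> \<le> (\<Sum>k<n. \<epsilon> / 3)"
          by (rule order_trans[OF sum_abs sum_mono]) (rule close)
        finally have "\<bar>((\<Sum>k<n. \<phi> (w k)) - n * ?m) - (\<Sum>k<n. u (w k) - v (w k))\<bar> \<le> n * (\<epsilon> / 3)" by simp
        moreover have "U \<le> n * (\<epsilon> / 3)" using n1(2) \<epsilon> by (simp add: field_simps)
        moreover have "n * \<epsilon> = n * (\<epsilon> / 3) + n * (\<epsilon> / 3) + n * (\<epsilon> / 3)" by simp
        ultimately show "n * (\<epsilon> / 3) + U < \<bar>\<Sum>k<n. u (w k) - v (w k)\<bar>" using * by linarith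
      qed
      have [measurable]: "v \<in> borel_measurable (borel \<Otimes>\<^sub>M borel)"
        unfolding v_def by (rule measurable_pair_kernel_integral[OF um])
      have "{w \<in> space (skeleton_law r K x). n * (\<epsilon> / 3) + U < \<bar>\<Sum>k<n. u (w k) - v (w k)\<bar>} \<in> sets (skeleton_law r K x)"
        by measurable
      then show "{w. n * (\<epsilon> / 3) + U < \<bar>\<Sum>k<n. u (w k) - v (w k)\<bar>} \<in> sets (skeleton_law r K x)"
        by (simp add: space_skeleton_law)
    qed
    also have "\<dots> \<le> 4 * U\<^sup>2 / (n * (\<epsilon> / 3)\<^sup>2)"
      unfolding v_def by (rule skeleton_coboundary_tail) (use ub \<epsilon> n1 in \<open>auto simp: U_def\<close>)
    also have "\<dots> \<le> \<eta>"
    proof -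
      have "36 * U\<^sup>2 \<le> n * (\<eta> * \<epsilon>\<^sup>2)" using n1(3) \<epsilon> \<eta> by (simp add: pos_divide_le_eq)
      then have "4 * U\<^sup>2 \<le> \<eta> * (n * (\<epsilon> / 3)\<^sup>2)" by (simp add: power_divide mult_ac)
      then show ?thesis using n1(1) \<epsilon> by (subst pos_divide_le_eq) auto
    qed
    finally show ?thesis .
  qed
  then show ?thesis by blast
qed

text \<open>Only the last transition is used, so the bound depends neither on \<open>x\<close> nor
  on \<open>n\<close>. Index 0 is excluded because the law of its pair is dictated by
  \<open>x\<close>.\<close>

lemma nn_integral_component_Suc_le:
  assumes [measurable]: "g \<in> borel_measurable (borel \<Otimes>\<^sub>M borel)"
  shows "(\<integral>\<^sup>+w. g (w (Suc n)) \<partial>skeleton_law r K x) \<le> ennreal C * (\<integral>\<^sup>+z. g z \<partial>\<Lambda>)"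
proof -
  interpret P: prob_space "skeleton_law r K x" by (rule prob_space_skeleton_law)
  have "(\<integral>\<^sup>+w. g (w (Suc n)) \<partial>skeleton_law r K x) = (\<integral>\<^sup>+w. \<integral>\<^sup>+z. g z \<partial>pair_kernel (w n) \<partial>skeleton_law r K x)"
    by (simp add: nn_integral_skeleton_component pair_kernel_def)
  also have "\<dots> \<le> (\<integral>\<^sup>+w. ennreal C * (\<integral>\<^sup>+z. g z \<partial>\<Lambda>) \<partial>skeleton_law r K x)"
    by (intro nn_integral_mono pair_kernel_le) measurable
  finally show ?thesis by (simp add: P.emeasure_space_1)
qed

lemma nn_integral_initial_holding:
  "(\<integral>\<^sup>+w. snd (w 0) \<partial>skeleton_law r K x) = 1 / ennreal (r x)"
proof -
  interpret P: prob_space "skeleton_law r K x" by (rule prob_space_skeleton_law)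
  have [measurable]: "(\<lambda>y. \<integral>\<^sup>+s. s \<partial>holding_law (r y)) \<in> borel_measurable borel"
    using measurable_holding_integral[of snd] by simp
  show ?thesis
    by (simp add: nn_integral_skeleton_component nn_integral_with_holding nn_integral_return
        nn_integral_holding_law nn P.emeasure_space_1)
qed

lemma \<Lambda>_mean_finite: "(\<integral>\<^sup>+z. snd z \<partial>\<Lambda>) < \<infinity>"
  using inv_r by (simp add: nn_integral_with_holding sets_lam nn_integral_holding_law nn)

lemma \<Theta>_mean: "(\<integral>\<^sup>+z. snd z \<partial>\<Theta>) = (\<integral>\<^sup>+y. 1 / ennreal (r y) \<partial>\<pi>0)"
  by (simp add: nn_integral_with_holding sets_\<pi>0 nn_integral_holding_law nn)

lemma \<Theta>_mean_finite: "(\<integral>\<^sup>+z. snd z \<partial>\<Theta>) < \<infinity>"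
  using \<Theta>_le[of snd] \<Lambda>_mean_finite
  by (auto simp: ennreal_mult_less_top intro: le_less_trans)

text \<open>Every holding time has finite mean: the first because \<open>r x\<close> is positive,
  the others by domination by \<open>\<Lambda>\<close>.\<close>

lemma AE_holding_finite:
  assumes "0 < r x"
  shows "AE w in skeleton_law r K x. \<forall>k. snd (w k) \<noteq> \<infinity>"
proof (subst AE_all_countable, rule allI)
  fix k
  have "(\<integral>\<^sup>+w. snd (w k) \<partial>skeleton_law r K x) \<noteq> \<infinity>"
  proof (cases k)
    case 0
    have "1 / ennreal (r x) = ennreal (1 / r x)" using divide_ennreal[of 1 "r x"] assms by simp
    then show ?thesis using 0 nn_integral_initial_holding[of x] by simp
  next
    case (Suc n)
    have "ennreal C * (\<integral>\<^sup>+z. snd z \<partial>\<Lambda>) < \<infinity>" using \<Lambda>_mean_finite by (simp add: ennreal_mult_less_top)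
    then show ?thesis using Suc nn_integral_component_Suc_le[of snd x n] by (auto simp: top_unique)
  qed
  then show "AE w in skeleton_law r K x. snd (w k) \<noteq> \<infinity>"
    by (intro nn_integral_PInf_AE) measurable
qed

lemma truncation_tendsto_0: "(\<lambda>L. \<integral>\<^sup>+z. (snd z - of_nat L) \<partial>\<Lambda>) \<longlonglongrightarrow> 0"
proof -
  have "(\<lambda>L. \<integral>\<^sup>+z. (snd z - of_nat L) \<partial>\<Lambda>) \<longlonglongrightarrow> (\<integral>\<^sup>+z. 0 \<partial>\<Lambda>)"
  proof (rule nn_integral_dominated_convergence[where w=snd])
    have "AE z in \<Lambda>. snd z \<noteq> \<infinity>"
      using \<Lambda>_mean_finite by (intro nn_integral_PInf_AE) auto
    then show "AE z in \<Lambda>. (\<lambda>L. snd z - of_nat L) \<longlonglongrightarrow> 0"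
    proof eventually_elim
      fix z :: "'a \<times> ennreal" assume "snd z \<noteq> \<infinity>"
      then obtain N :: nat where N: "snd z < of_nat N" using ennreal_Ex_less_of_nat[of "snd z"] by (auto simp: less_top)
      have "\<forall>\<^sub>F L in sequentially. snd z - of_nat L = 0"
        using eventually_ge_at_top[of N]
      proof eventually_elim
        case (elim L)
        then have "of_nat N \<le> (of_nat L :: ennreal)" by simp
        with N have "snd z \<le> of_nat L" by (meson less_imp_le order_trans)
        then show ?case using \<open>snd z \<noteq> \<infinity>\<close> by (simp add: diff_eq_0_iff_ennreal less_top)
      qed
      then show "(\<lambda>L. snd z - of_nat L) \<longlonglongrightarrow> 0" by (rule tendsto_eventually)
    qed
  qed (use \<Lambda>_mean_finite in \<open>auto simp: diff_le_self_ennreal\<close>)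
  then show ?thesis by simp
qed

text \<open>Subtraction in \<open>ennreal\<close> is cut off at 0, so the right side is
  \<open>G\<close> times the excess of \<open>s\<close> over the level \<open>L\<close>.\<close>

lemma truncation_error:
  assumes "\<bar>a\<bar> \<le> G" "0 < G"
  shows "ennreal \<bar>a * enn2real s - a * enn2real (min s (of_nat L))\<bar> \<le> ennreal G * (s - of_nat L)"
proof (cases s)
  \<comment> \<open>Here \<open>enn2real\<close> sends an infinite \<open>s\<close> to 0 while the
    truncated value is \<open>L\<close>; the infinite right side, with \<open>G\<close> positive,
    covers the mismatch.\<close>
  case top
  then show ?thesis using assms by (simp add: ennreal_mult_top)
next
  case (real t)
  have L: "of_nat L = ennreal (real L)" by (simp add: ennreal_of_nat_eq_real_of_nat)
  have "enn2real (min s (of_nat L)) = min t L" using real unfolding L by (cases "t \<le> L") (auto simp: min_def)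
  then have "\<bar>a * enn2real s - a * enn2real (min s (of_nat L))\<bar> = \<bar>a\<bar> * (t - min t L)"
    using real by (simp add: right_diff_distrib[symmetric] abs_mult)
  also have "\<dots> \<le> G * max 0 (t - L)"
    using assms by (intro mult_mono) auto
  finally have "ennreal \<bar>a * enn2real s - a * enn2real (min s (of_nat L))\<bar> \<le> ennreal (G * max 0 (t - L))"
    by (rule ennreal_leI)
  also have "\<dots> = ennreal G * (s - of_nat L)"
    using real assms by (simp add: L ennreal_mult ennreal_minus max_def ennreal_neg)
  finally show ?thesis .
qed

lemma integrable_holding:
  assumes [measurable]: "g \<in> borel_measurable borel" and g: "\<And>y. \<bar>g y\<bar> \<le> G"
  shows "integrable \<Theta> (\<lambda>z. g (fst z) * enn2real (snd z))"
proof (rule integrableI_bounded)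
  have "(\<integral>\<^sup>+z. ennreal (norm (g (fst z) * enn2real (snd z))) \<partial>\<Theta>) \<le> (\<integral>\<^sup>+z. ennreal G * snd z \<partial>\<Theta>)"
  proof (rule nn_integral_mono)
    fix z
    have "ennreal (norm (g (fst z) * enn2real (snd z))) = ennreal \<bar>g (fst z)\<bar> * ennreal (enn2real (snd z))"
      by (simp add: abs_mult ennreal_mult)
    also have "\<dots> \<le> ennreal G * snd z"
      using g by (intro mult_mono ennreal_leI) (auto simp: ennreal_enn2real_if)
    finally show "ennreal (norm (g (fst z) * enn2real (snd z))) \<le> ennreal G * snd z" .
  qed
  also have "\<dots> < \<infinity>" using \<Theta>_mean_finite by (simp add: nn_integral_cmult ennreal_mult_less_top)
  finally show "(\<integral>\<^sup>+z. ennreal (norm (g (fst z) * enn2real (snd z))) \<partial>\<Theta>) < \<infinity>" .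
qed measurable

text \<open>Holding times need not be square integrable, hence the truncation.\<close>

lemma wlln_holding:
  assumes gm[measurable]: "g \<in> borel_measurable borel" and g: "\<And>y. \<bar>g y\<bar> \<le> G" and G: "0 < G"
    and b: "0 < b" and \<epsilon>: "0 < \<epsilon>" and \<eta>: "0 < \<eta>"
  shows "\<exists>n0. \<forall>n\<ge>n0. \<forall>x. b \<le> r x \<longrightarrow> measure (skeleton_law r K x)
    {w. n * \<epsilon> < \<bar>(\<Sum>k<n. g (fst (w k)) * enn2real (snd (w k)))
        - n * (\<integral>z. g (fst z) * enn2real (snd z) \<partial>\<Theta>)\<bar>} \<le> \<eta>"
proof -
  let ?\<phi> = "\<lambda>z. g (fst z) * enn2real (snd z)"
  let ?m = "\<integral>z. ?\<phi> z \<partial>\<Theta>"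
  \<comment> \<open>The bound \<open>\<epsilon> / 3\<close> is for the change of the stationary mean
    under truncation, and \<open>\<eta> * \<epsilon> / 12\<close> for half of the Markov estimate of
    the truncated-off part.\<close>
  define \<delta> where "\<delta> = min (\<epsilon> / 3) (\<eta> * \<epsilon> / 12)"
  have \<delta>: "0 < \<delta>" "\<delta> \<le> \<epsilon> / 3" "\<delta> \<le> \<eta> * \<epsilon> / 12" using \<epsilon> \<eta> by (auto simp: \<delta>_def)
  have "(\<lambda>L. ennreal G * (ennreal C * (\<integral>\<^sup>+z. (snd z - of_nat L) \<partial>\<Lambda>))) \<longlonglongrightarrow> ennreal G * (ennreal C * 0)"
    by (intro ennreal_tendsto_cmult truncation_tendsto_0) auto
  then have "\<forall>\<^sub>F L in sequentially. ennreal G * (ennreal C * (\<integral>\<^sup>+z. (snd z - of_nat L) \<partial>\<Lambda>)) < ennreal \<delta>"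
    using \<delta> by (intro order_tendstoD(2)[of _ 0]) auto
  then obtain L :: nat where L: "ennreal G * (ennreal C * (\<integral>\<^sup>+z. (snd z - of_nat L) \<partial>\<Lambda>)) < ennreal \<delta>"
    using eventually_happens'[OF sequentially_bot] by blast
  define \<phi> where "\<phi> z = g (fst z) * enn2real (min (snd z) (of_nat L))" for z :: "'a \<times> ennreal"
  have [measurable]: "\<phi> \<in> borel_measurable (borel \<Otimes>\<^sub>M borel)" unfolding \<phi>_def by measurable
  have minL: "enn2real (min s (of_nat L)) \<le> L" for s
    using enn2real_mono[of "min s (of_nat L)" "of_nat L"] by (simp add: less_top[symmetric])
  have \<phi>b: "\<bar>\<phi> z\<bar> \<le> G * L" for z
    unfolding \<phi>_def abs_mult using g G minL by (intro mult_mono) auto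
  have err: "ennreal \<bar>?\<phi> z - \<phi> z\<bar> \<le> ennreal G * (snd z - of_nat L)" for z
    unfolding \<phi>_def by (rule truncation_error[OF g G])
  let ?m' = "\<integral>z. \<phi> z \<partial>\<Theta>"
  have mm: "\<bar>?m - ?m'\<bar> \<le> \<delta>"
  proof -
    interpret \<Theta>: prob_space \<Theta> by (rule prob_\<Theta>)
    have i: "integrable \<Theta> ?\<phi>" "integrable \<Theta> \<phi>"
      using \<phi>b by (auto intro!: integrable_holding[OF gm g] \<Theta>.integrable_const_bound[where B="G * L"])
    then have "ennreal \<bar>?m - ?m'\<bar> = ennreal (norm (\<integral>z. ?\<phi> z - \<phi> z \<partial>\<Theta>))" by simp
    also have "\<dots> \<le> (\<integral>\<^sup>+z. ennreal (norm (?\<phi> z - \<phi> z)) \<partial>\<Theta>)"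
      using i by (intro integral_norm_bound_ennreal) auto
    also have "\<dots> \<le> (\<integral>\<^sup>+z. ennreal G * (snd z - of_nat L) \<partial>\<Theta>)"
      using err by (intro nn_integral_mono) simp
    also have "\<dots> = ennreal G * (\<integral>\<^sup>+z. (snd z - of_nat L) \<partial>\<Theta>)" by (intro nn_integral_cmult) measurable
    also have "\<dots> \<le> ennreal G * (ennreal C * (\<integral>\<^sup>+z. (snd z - of_nat L) \<partial>\<Lambda>))"
      by (intro mult_left_mono \<Theta>_le) auto
    finally show ?thesis using L \<delta> by (auto dest: le_less_trans simp: ennreal_less_iff)
  qed
  have "\<exists>n0. \<forall>n\<ge>n0. \<forall>x. measure (skeleton_law r K x)
    {w. n * (\<epsilon> / 3) < \<bar>(\<Sum>k<n. \<phi> (w k)) - n * ?m'\<bar>} \<le> \<eta> / 2"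
    by (rule wlln_bounded[OF _ \<phi>b]) (use \<epsilon> \<eta> in auto)
  then obtain n1 where n1: "\<And>n x. n1 \<le> n \<Longrightarrow> measure (skeleton_law r K x)
    {w. n * (\<epsilon> / 3) < \<bar>(\<Sum>k<n. \<phi> (w k)) - n * ?m'\<bar>} \<le> \<eta> / 2"
    by blast
  \<comment> \<open>The second entry makes the share \<open>G / b\<close> of the first holding time
    at most \<open>n * \<epsilon> * \<eta> / 12\<close>, the other half of the Markov
    estimate.\<close>
  define n0 where "n0 = max n1 (Suc (nat \<lceil>12 * G / (b * \<epsilon> * \<eta>)\<rceil>))"
  have "measure (skeleton_law r K x) {w. n * \<epsilon> < \<bar>(\<Sum>k<n. ?\<phi> (w k)) - n * ?m\<bar>} \<le> \<eta>"
    if n: "n0 \<le> n" and x: "b \<le> r x" for n x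
  proof -
    interpret P: prob_space "skeleton_law r K x" by (rule prob_space_skeleton_law)
    have n2: "n1 \<le> n" "0 < n" "12 * G / (b * \<epsilon> * \<eta>) \<le> n"
      using n unfolding n0_def by linarith+
    let ?S = "\<lambda>w. ennreal G * (\<Sum>k<n. snd (w k) - of_nat L)"
    let ?A = "{w. n * (\<epsilon> / 3) < \<bar>(\<Sum>k<n. \<phi> (w k)) - n * ?m'\<bar>}"
    let ?B = "{w \<in> space (skeleton_law r K x). 1 \<le> ennreal (3 / (n * \<epsilon>)) * ?S w}"
    have "?A = {w \<in> space (skeleton_law r K x). n * (\<epsilon> / 3) < \<bar>(\<Sum>k<n. \<phi> (w k)) - n * ?m'\<bar>}"
      by (simp add: space_skeleton_law)
    also have "\<dots> \<in> sets (skeleton_law r K x)" by measurable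
    finally have A[measurable]: "?A \<in> sets (skeleton_law r K x)" .
    have B[measurable]: "?B \<in> sets (skeleton_law r K x)" by measurable
    \<comment> \<open>Three errors of size \<open>n * (\<epsilon> / 3)\<close> are balanced: the
      fluctuation of the truncated sum (\<open>?A\<close>), the truncated-off part of the sum
      (\<open>?B\<close>), and the deterministic change of mean.\<close>
    have incl: "{w. n * \<epsilon> < \<bar>(\<Sum>k<n. ?\<phi> (w k)) - n * ?m\<bar>} \<subseteq> ?A \<union> ?B"
    proof
      fix w assume "w \<in> {w. n * \<epsilon> < \<bar>(\<Sum>k<n. ?\<phi> (w k)) - n * ?m\<bar>}"
      then have *: "n * \<epsilon> < \<bar>(\<Sum>k<n. ?\<phi> (w k)) - n * ?m\<bar>" by simp
      show "w \<in> ?A \<union> ?B"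
      proof (rule ccontr)
        assume "w \<notin> ?A \<union> ?B"
        then have a: "\<bar>(\<Sum>k<n. \<phi> (w k)) - n * ?m'\<bar> \<le> n * (\<epsilon> / 3)"
          and bb: "ennreal (3 / (n * \<epsilon>)) * ?S w < 1"
          by (auto simp: space_skeleton_law not_le not_less)
        have "ennreal \<bar>(\<Sum>k<n. ?\<phi> (w k)) - (\<Sum>k<n. \<phi> (w k))\<bar> \<le> ennreal (\<Sum>k<n. \<bar>?\<phi> (w k) - \<phi> (w k)\<bar>)"
          by (intro ennreal_leI) (simp add: sum_subtractf[symmetric] sum_abs)
        also have "\<dots> = (\<Sum>k<n. ennreal \<bar>?\<phi> (w k) - \<phi> (w k)\<bar>)" by (rule sum_ennreal[symmetric]) simp
        also have "\<dots> \<le> ?S w" unfolding sum_distrib_left by (intro sum_mono err)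
        finally have "ennreal (3 / (n * \<epsilon>)) * ennreal \<bar>(\<Sum>k<n. ?\<phi> (w k)) - (\<Sum>k<n. \<phi> (w k))\<bar> < 1"
          using bb by (meson le_less_trans mult_left_mono zero_le)
        then have "3 / (n * \<epsilon>) * \<bar>(\<Sum>k<n. ?\<phi> (w k)) - (\<Sum>k<n. \<phi> (w k))\<bar> < 1"
          using \<epsilon> by (simp add: ennreal_mult[symmetric] ennreal_less_one_iff)
        then have "\<bar>(\<Sum>k<n. ?\<phi> (w k)) - (\<Sum>k<n. \<phi> (w k))\<bar> < n * (\<epsilon> / 3)"
          using \<epsilon> n2 by (simp add: field_simps)
        moreover have "\<bar>n * ?m - n * ?m'\<bar> \<le> n * (\<epsilon> / 3)"
        proof -
          have "\<bar>n * ?m - n * ?m'\<bar> = n * \<bar>?m - ?m'\<bar>" by (simp add: right_diff_distrib[symmetric] abs_mult)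
          also have "\<dots> \<le> n * (\<epsilon> / 3)" using mm \<delta> by (intro mult_left_mono) auto
          finally show ?thesis .
        qed
        moreover have "n * \<epsilon> = n * (\<epsilon> / 3) + n * (\<epsilon> / 3) + n * (\<epsilon> / 3)" by simp
        ultimately show False using * a by linarith
      qed
    qed
    have ES: "(\<integral>\<^sup>+w. ?S w \<partial>skeleton_law r K x) \<le> ennreal (G / b + n * \<delta>)"
    proof -
      let ?\<tau> = "\<integral>\<^sup>+z. (snd z - of_nat L) \<partial>\<Lambda>"
      \<comment> \<open>Only index 0 feels the initial state, and its mean is at most
        \<open>1 / b\<close>; this is where \<open>b \<le> r x\<close> enters.\<close>
      have "(\<integral>\<^sup>+w. snd (w k) - of_nat L \<partial>skeleton_law r K x)
          \<le> (if k = 0 then ennreal (1 / b) else 0) + ennreal C * ?\<tau>" for k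
      proof (cases k)
        case 0
        have "(\<integral>\<^sup>+w. snd (w 0) - of_nat L \<partial>skeleton_law r K x) \<le> (\<integral>\<^sup>+w. snd (w 0) \<partial>skeleton_law r K x)"
          by (intro nn_integral_mono diff_le_self_ennreal)
        also have "\<dots> = ennreal (1 / r x)"
          using divide_ennreal[of 1 "r x"] b x by (simp add: nn_integral_initial_holding)
        also have "\<dots> \<le> ennreal (1 / b)" using b x by (intro ennreal_leI divide_left_mono) auto
        finally show ?thesis using 0 by (simp add: add_increasing2)
      next
        case (Suc j)
        then show ?thesis using nn_integral_component_Suc_le[of "\<lambda>z. snd z - of_nat L" x j] by simp
      qed
      then have "(\<Sum>k<n. \<integral>\<^sup>+w. snd (w k) - of_nat L \<partial>skeleton_law r K x)
         \<le> (\<Sum>k<n. (if k = 0 then ennreal (1 / b) else 0) + ennreal C * ?\<tau>)" by (rule sum_mono)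
      also have "\<dots> = ennreal (1 / b) + of_nat n * (ennreal C * ?\<tau>)"
        using n2 by (simp add: sum.distrib sum.delta)
      finally have 1: "(\<Sum>k<n. \<integral>\<^sup>+w. snd (w k) - of_nat L \<partial>skeleton_law r K x)
         \<le> ennreal (1 / b) + of_nat n * (ennreal C * ?\<tau>)" .
      have "(\<integral>\<^sup>+w. ?S w \<partial>skeleton_law r K x)
         = ennreal G * (\<Sum>k<n. \<integral>\<^sup>+w. snd (w k) - of_nat L \<partial>skeleton_law r K x)"
        by (subst nn_integral_cmult, measurable) (subst nn_integral_sum, measurable)
      also have "\<dots> \<le> ennreal G * (ennreal (1 / b) + of_nat n * (ennreal C * ?\<tau>))"
        by (intro mult_left_mono 1) simp
      also have "\<dots> = ennreal (G / b) + of_nat n * (ennreal G * (ennreal C * ?\<tau>))"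
        using G b by (simp add: distrib_left mult_ac flip: ennreal_mult)
      also have "\<dots> \<le> ennreal (G / b) + of_nat n * ennreal \<delta>"
        using L by (intro add_left_mono mult_left_mono) auto
      also have "\<dots> = ennreal (G / b + n * \<delta>)"
        using G b \<delta> by (simp add: ennreal_of_nat_eq_real_of_nat ennreal_mult)
      finally show ?thesis .
    qed
    have "emeasure (skeleton_law r K x) ?B \<le> ennreal (3 / (n * \<epsilon>)) * (\<integral>\<^sup>+w. ?S w * indicator (space (skeleton_law r K x)) w \<partial>skeleton_law r K x)"
      by (rule nn_integral_Markov_inequality) measurable
    also have "\<dots> = ennreal (3 / (n * \<epsilon>)) * (\<integral>\<^sup>+w. ?S w \<partial>skeleton_law r K x)"
      by (simp add: space_skeleton_law)
    also have "\<dots> \<le> ennreal (3 / (n * \<epsilon>)) * ennreal (G / b + n * \<delta>)"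
      by (intro mult_left_mono ES) simp
    also have "\<dots> = ennreal (3 / (n * \<epsilon>) * (G / b + n * \<delta>))"
      using G b \<delta> \<epsilon> by (intro ennreal_mult[symmetric]) auto
    also have "3 / (n * \<epsilon>) * (G / b + n * \<delta>) \<le> \<eta> / 2"
    proof -
      have "12 * G \<le> n * (b * \<epsilon> * \<eta>)" using n2(3) b \<epsilon> \<eta> by (simp add: pos_divide_le_eq)
      then have "G / b \<le> n * \<epsilon> * \<eta> / 12" using b by (simp add: field_simps)
      moreover have "n * \<delta> \<le> n * \<epsilon> * \<eta> / 12"
        using mult_left_mono[OF \<delta>(3), of n] by (simp add: mult_ac)
      ultimately have "G / b + n * \<delta> \<le> n * \<epsilon> * \<eta> / 6" by linarith
      then have "3 / (n * \<epsilon>) * (G / b + n * \<delta>) \<le> 3 / (n * \<epsilon>) * (n * \<epsilon> * \<eta> / 6)"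
        using \<epsilon> by (intro mult_left_mono) auto
      also have "\<dots> = \<eta> / 2" using \<epsilon> n2 by simp
      finally show ?thesis .
    qed
    finally have "measure (skeleton_law r K x) ?B \<le> \<eta> / 2"
      using \<eta> by (simp add: P.emeasure_eq_measure ennreal_leI)
    moreover have "measure (skeleton_law r K x) ?A \<le> \<eta> / 2" by (rule n1) fact
    moreover have "measure (skeleton_law r K x) {w. n * \<epsilon> < \<bar>(\<Sum>k<n. ?\<phi> (w k)) - n * ?m\<bar>}
        \<le> measure (skeleton_law r K x) ?A + measure (skeleton_law r K x) ?B"
      by (rule order_trans[OF P.finite_measure_mono[OF incl] measure_Un_le[OF A B]])
        (intro sets.Un A B)
    ultimately show ?thesis by linarith
  qed
  then show ?thesis by blast
qed

end

section \<open>Time averages along the path\<close>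

lemma set_integral_abs_le:
  fixes h :: "real \<Rightarrow> real"
  assumes A: "A \<in> sets lborel" "emeasure lborel A < \<infinity>" and h: "set_integrable lborel A h"
    and B: "\<And>t. \<bar>h t\<bar> \<le> B"
  shows "\<bar>LINT t:A|lborel. h t\<bar> \<le> B * measure lborel A"
proof -
  have "\<bar>LINT t:A|lborel. h t\<bar> \<le> (\<integral>t. \<bar>indicator A t *\<^sub>R h t\<bar> \<partial>lborel)"
    unfolding set_lebesgue_integral_def by (rule integral_abs_bound)
  also have "\<dots> \<le> (\<integral>t. B * indicator A t \<partial>lborel)"
  proof (rule integral_mono)
    show "integrable lborel (\<lambda>t. \<bar>indicator A t *\<^sub>R h t\<bar>)" using h by (simp add: set_integrable_def)
    show "integrable lborel (\<lambda>t. B * indicator A t)" using A by simp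
    show "\<bar>indicator A t *\<^sub>R h t\<bar> \<le> B * indicator A t" for t using B[of t] by (simp add: indicator_def)
  qed
  also have "\<dots> = B * measure lborel A" using A by simp
  finally show ?thesis .
qed

lemma jump_time_eq_sum:
  assumes "\<And>k. snd (w k) \<noteq> \<infinity>"
  shows "jump_time w n = ennreal (\<Sum>k<n. enn2real (snd (w k)))"
proof -
  have "snd (w k) = ennreal (enn2real (snd (w k)))" for k using assms[of k] by (simp add: less_top)
  then have "jump_time w n = (\<Sum>k<n. ennreal (enn2real (snd (w k))))" by (simp add: jump_time_def)
  then show ?thesis by (simp add: sum_ennreal)
qed

text \<open>One realization is fixed, so the estimates on the path are deterministic. The two
  conditions on \<open>w\<close> hold almost surely when the initial rate is positive.\<close>

locale nonexplosive_skeleton =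
  fixes w :: "nat \<Rightarrow> 'a::topological_space \<times> ennreal" and h :: "'a \<Rightarrow> real" and B :: real
  assumes finite: "\<And>k. snd (w k) \<noteq> \<infinity>"
    and nonexplosive: "(SUP n. jump_time w n) = \<infinity>"
    and bounded: "\<And>y. \<bar>h y\<bar> \<le> B"
begin

definition T :: "nat \<Rightarrow> real" where "T n = (\<Sum>k<n. enn2real (snd (w k)))"

lemma T_0[simp]: "T 0 = 0" and T_Suc: "T (Suc n) = T n + enn2real (snd (w n))"
  by (simp_all add: T_def)

lemma T_nonneg: "0 \<le> T n"
  by (simp add: T_def sum_nonneg)

lemma T_mono: "T n \<le> T (Suc n)"
  by (simp add: T_Suc)

lemma jump_time_eq: "jump_time w n = ennreal (T n)"
  unfolding T_def using finite by (rule jump_time_eq_sum)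

lemma path_eq: "T n \<le> t \<Longrightarrow> t < T (Suc n) \<Longrightarrow> skeleton_path w t = fst (w n)"
  using T_nonneg[of n]
  by (intro skeleton_path_eq nonexplosive) (auto simp: jump_time_eq ennreal_leI ennreal_less_iff)

lemma path_integrable:
  assumes A[measurable]: "A \<in> sets borel" and A0: "A \<subseteq> {0..}" and fin: "emeasure lborel A < \<infinity>"
  shows "set_integrable lborel A (\<lambda>t. h (skeleton_path w t))"
proof -
  \<comment> \<open>The path factors through a measurable index in the natural numbers, from which
    every function is measurable; so \<open>h\<close> may be any bounded function.\<close>
  have [measurable]: "(\<lambda>t. LEAST n. ennreal t < jump_time w (Suc n)) \<in> borel \<rightarrow>\<^sub>M count_space UNIV"
    by measurable
  have "(\<lambda>t. h (fst (w (LEAST n. ennreal t < jump_time w (Suc n))))) \<in> borel_measurable borel"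
    by (rule measurable_compose[where f="\<lambda>t. LEAST n. ennreal t < jump_time w (Suc n)" and N="count_space UNIV"]) measurable
  then have "(\<lambda>t. indicator A t *\<^sub>R h (fst (w (LEAST n. ennreal t < jump_time w (Suc n))))) \<in> borel_measurable lborel"
    by simp
  also have "(\<lambda>t. indicator A t *\<^sub>R h (fst (w (LEAST n. ennreal t < jump_time w (Suc n)))))
     = (\<lambda>t. indicator A t *\<^sub>R h (skeleton_path w t))"
    using A0 nonexplosive by (auto simp: skeleton_path_def indicator_def fun_eq_iff)
  finally have m: "(\<lambda>t. indicator A t *\<^sub>R h (skeleton_path w t)) \<in> borel_measurable lborel" .
  have B0: "0 \<le> B" using bounded abs_ge_zero order_trans by blast
  show ?thesis
    unfolding set_integrable_def
  proof (rule Bochner_Integration.integrable_bound[OF _ m])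
    show "integrable lborel (\<lambda>t. B * indicator A t)" using fin by simp
    show "AE t in lborel. norm (indicator A t *\<^sub>R h (skeleton_path w t)) \<le> norm (B * indicator A t)"
      using bounded B0 by (auto simp: indicator_def)
  qed
qed

lemma integral_to_jump_time:
  "(LINT t:{0..<T n}|lborel. h (skeleton_path w t)) = (\<Sum>k<n. h (fst (w k)) * enn2real (snd (w k)))"
proof (induction n)
  case 0 show ?case by (simp add: set_lebesgue_integral_def)
next
  case (Suc n)
  have split: "{0..<T (Suc n)} = {0..<T n} \<union> {T n..<T (Suc n)}"
    using T_nonneg[of n] T_mono[of n] by (auto simp: ivl_disj_un)
  have "(LINT t:{T n..<T (Suc n)}|lborel. h (skeleton_path w t)) = (LINT t:{T n..<T (Suc n)}|lborel. h (fst (w n)))"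
    by (rule set_lebesgue_integral_cong) (auto simp: path_eq)
  also have "\<dots> = h (fst (w n)) * enn2real (snd (w n))"
    using T_mono[of n] by (simp add: set_lebesgue_integral_def T_Suc)
  finally have *: "(LINT t:{T n..<T (Suc n)}|lborel. h (skeleton_path w t)) = h (fst (w n)) * enn2real (snd (w n))" .
  have "(LINT t:{0..<T (Suc n)}|lborel. h (skeleton_path w t))
     = (LINT t:{0..<T n}|lborel. h (skeleton_path w t)) + (LINT t:{T n..<T (Suc n)}|lborel. h (skeleton_path w t))"
    unfolding split using T_nonneg[of n] T_mono[of n]
    by (intro set_integral_Un path_integrable) auto
  then show ?case using Suc * by simp
qed

text \<open>The index \<open>n\<close> is arbitrary: the jump time \<open>T n\<close> may lie on
  either side of \<open>t\<close>, and the two integrals differ by one over the interval between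
  them. This makes a deterministic choice of \<open>n\<close> possible.\<close>

lemma integral_deviation:
  assumes t: "0 \<le> t"
  shows "\<bar>LINT s:{0..t}|lborel. h (skeleton_path w s)\<bar>
    \<le> \<bar>\<Sum>k<n. h (fst (w k)) * enn2real (snd (w k))\<bar> + B * \<bar>t - T n\<bar>"
proof (cases "T n \<le> t")
  case True
  have split: "{0..t} = {0..<T n} \<union> {T n..t}" using True T_nonneg[of n] by auto
  have "(LINT s:{0..t}|lborel. h (skeleton_path w s))
     = (LINT s:{0..<T n}|lborel. h (skeleton_path w s)) + (LINT s:{T n..t}|lborel. h (skeleton_path w s))"
    unfolding split using T_nonneg[of n] True
    by (intro set_integral_Un path_integrable) auto
  moreover have "\<bar>LINT s:{T n..t}|lborel. h (skeleton_path w s)\<bar> \<le> B * measure lborel {T n..t}"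
    using T_nonneg[of n] True by (intro set_integral_abs_le path_integrable bounded) auto
  ultimately show ?thesis using True by (simp add: integral_to_jump_time)
next
  case False
  have split: "{0..<T n} = {0..t} \<union> {t<..<T n}" using False t by auto
  have "(LINT s:{0..<T n}|lborel. h (skeleton_path w s))
     = (LINT s:{0..t}|lborel. h (skeleton_path w s)) + (LINT s:{t<..<T n}|lborel. h (skeleton_path w s))"
    unfolding split using t False
    by (intro set_integral_Un path_integrable) auto
  moreover have "\<bar>LINT s:{t<..<T n}|lborel. h (skeleton_path w s)\<bar> \<le> B * measure lborel {t<..<T n}"
    using t False by (intro set_integral_abs_le path_integrable bounded) auto
  ultimately show ?thesis using False by (simp add: integral_to_jump_time)
qed

end

section \<open>Non-explosion, the time-stationary law, and concentration of time averages\<close>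

context ergodic_jump_kernel begin

definition mean_holding :: real where
  "mean_holding = (\<integral>z. enn2real (snd z) \<partial>\<Theta>)"

lemma AE_\<Theta>_finite: "AE z in \<Theta>. snd z \<noteq> \<infinity>"
  using \<Theta>_mean_finite by (intro nn_integral_PInf_AE) auto

lemma ennreal_mean_holding: "ennreal mean_holding = (\<integral>\<^sup>+y. 1 / ennreal (r y) \<partial>\<pi>0)"
proof -
  have "integrable \<Theta> (\<lambda>z. enn2real (snd z))" using integrable_holding[of "\<lambda>_. 1" 1] by simp
  then have "ennreal mean_holding = (\<integral>\<^sup>+z. ennreal (enn2real (snd z)) \<partial>\<Theta>)"
    unfolding mean_holding_def by (intro nn_integral_eq_integral[symmetric]) auto
  also have "\<dots> = (\<integral>\<^sup>+z. snd z \<partial>\<Theta>)"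
    using AE_\<Theta>_finite by (intro nn_integral_cong_AE) (auto simp: less_top elim!: eventually_mono)
  finally show ?thesis by (simp add: \<Theta>_mean)
qed

text \<open>Rates are finite, so their reciprocals in \<open>ennreal\<close> never vanish and cannot
  have integral 0 under a probability.\<close>

lemma mean_holding_pos: "0 < mean_holding"
proof (rule ccontr)
  assume "\<not> 0 < mean_holding"
  then have "(\<integral>\<^sup>+y. 1 / ennreal (r y) \<partial>\<pi>0) = 0"
    using ennreal_mean_holding by (simp add: ennreal_neg)
  moreover have "(\<lambda>y. 1 / ennreal (r y)) \<in> borel_measurable \<pi>0"
    by (simp add: measurable_cong_sets[OF sets_\<pi>0 refl])
  ultimately have "AE y in \<pi>0. 1 / ennreal (r y) = 0"
    by (simp add: nn_integral_0_iff_AE)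
  moreover have "1 / ennreal (r y) \<noteq> 0" for y by (simp add: divide_ennreal_def ennreal_inverse_eq_0_iff)
  ultimately have "AE y in \<pi>0. False" by simp
  then show False using prob_space.AE_False[OF prob_\<pi>0] by simp
qed

text \<open>Non-explosion is read off from the weak law with \<open>g = 1\<close>. If all jump times
  stay below \<open>R\<close>, then for every \<open>n\<close> with
  \<open>R < n * (mean_holding / 2)\<close> the \<open>n\<close>-th one deviates from its mean by
  more than half of that mean, an event of arbitrarily small probability.\<close>

lemma AE_nonexplosive:
  assumes x: "0 < r x"
  shows "AE w in skeleton_law r K x. (SUP n. jump_time w n) = \<infinity>"
proof -
  interpret P: prob_space "skeleton_law r K x" by (rule prob_space_skeleton_law)
  have jm[measurable]: "(\<lambda>w. jump_time w n) \<in> borel_measurable (skeleton_law r K x)" for n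
    unfolding jump_time_def by measurable
  have "AE w in skeleton_law r K x. \<not> (SUP n. jump_time w n) \<le> of_nat R" for R
  proof -
    let ?A = "{w \<in> space (skeleton_law r K x). (SUP n. jump_time w n) \<le> of_nat R}"
    have A[measurable]: "?A \<in> sets (skeleton_law r K x)" by measurable
    have "measure (skeleton_law r K x) ?A \<le> \<eta>" if \<eta>: "0 < \<eta>" for \<eta>
    proof -
      have "\<exists>n0. \<forall>n\<ge>n0. \<forall>y. r x \<le> r y \<longrightarrow> measure (skeleton_law r K y)
        {w. n * (mean_holding / 2) < \<bar>(\<Sum>k<n. 1 * enn2real (snd (w k))) - n * (\<integral>z. 1 * enn2real (snd z) \<partial>\<Theta>)\<bar>} \<le> \<eta>"
        by (rule wlln_holding[where G=1]) (use x mean_holding_pos \<eta> in auto)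
      then obtain n0 where n0: "\<And>n. n0 \<le> n \<Longrightarrow> measure (skeleton_law r K x)
        {w. n * (mean_holding / 2) < \<bar>(\<Sum>k<n. enn2real (snd (w k))) - n * mean_holding\<bar>} \<le> \<eta>"
        by (auto simp: mean_holding_def)
      define n where "n = max n0 (Suc (nat \<lceil>R / (mean_holding / 2)\<rceil>))"
      have n: "n0 \<le> n" "R / (mean_holding / 2) < n" unfolding n_def by (simp, linarith)
      then have nR: "R < n * (mean_holding / 2)" using mean_holding_pos by (simp add: pos_divide_less_eq)
      have "{w. n * (mean_holding / 2) < \<bar>(\<Sum>k<n. enn2real (snd (w k))) - n * mean_holding\<bar>}
         = {w\<in>space (skeleton_law r K x). n * (mean_holding / 2) < \<bar>(\<Sum>k<n. enn2real (snd (w k))) - n * mean_holding\<bar>}"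
        by (simp add: space_skeleton_law)
      also have "\<dots> \<in> sets (skeleton_law r K x)" by measurable
      finally have "measure (skeleton_law r K x) ?A \<le> measure (skeleton_law r K x)
        {w. n * (mean_holding / 2) < \<bar>(\<Sum>k<n. enn2real (snd (w k))) - n * mean_holding\<bar>}"
      proof (intro P.finite_measure_mono_AE)
        show "AE w in skeleton_law r K x. w \<in> ?A \<longrightarrow>
          w \<in> {w. n * (mean_holding / 2) < \<bar>(\<Sum>k<n. enn2real (snd (w k))) - n * mean_holding\<bar>}"
          using AE_holding_finite[OF x]
        proof eventually_elim
          case (elim w)
          show ?case
          proof
            assume "w \<in> ?A"
            then have "jump_time w n \<le> of_nat R" by (auto simp: SUP_le_iff)
            moreover have "jump_time w n = ennreal (\<Sum>k<n. enn2real (snd (w k)))"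
              using elim by (intro jump_time_eq_sum) auto
            ultimately have "(\<Sum>k<n. enn2real (snd (w k))) \<le> R"
              by (simp add: ennreal_of_nat_eq_real_of_nat)
            moreover have "n * mean_holding = n * (mean_holding / 2) + n * (mean_holding / 2)" by simp
            ultimately show "w \<in> {w. n * (mean_holding / 2) < \<bar>(\<Sum>k<n. enn2real (snd (w k))) - n * mean_holding\<bar>}"
              using nR unfolding mem_Collect_eq by linarith
          qed
        qed
      qed
      also have "\<dots> \<le> \<eta>" by (rule n0) (rule n)
      finally show ?thesis .
    qed
    then have "measure (skeleton_law r K x) ?A \<le> 0" by (rule field_le_epsilon[of _ 0, simplified])
    then have "measure (skeleton_law r K x) ?A = 0" using measure_nonneg by (rule antisym)
    then have "emeasure (skeleton_law r K x) ?A = 0" by (simp add: P.emeasure_eq_measure)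
    then show ?thesis using A by (subst AE_iff_measurable[OF A]) auto
  qed
  then have "AE w in skeleton_law r K x. \<forall>R. \<not> (SUP n. jump_time w n) \<le> of_nat R"
    by (simp add: AE_all_countable)
  then show ?thesis
  proof eventually_elim
    case (elim w)
    show ?case
    proof (rule ccontr)
      assume "(SUP n. jump_time w n) \<noteq> \<infinity>"
      then have "(SUP n. jump_time w n) < top" by (simp only: infinity_ennreal_def less_top)
      then obtain R where "(SUP n. jump_time w n) < of_nat R"
        using ennreal_Ex_less_of_nat by blast
      then show False using elim by (auto dest: less_imp_le)
    qed
  qed
qed

abbreviation "\<pi> \<equiv> density \<pi>0 (\<lambda>x. 1 / ennreal (r x) / (\<integral>\<^sup>+y. 1 / ennreal (r y) \<partial>\<pi>0))"

text \<open>The renewal-reward identity. Given the state \<open>y\<close>, the holding time has mean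
  \<open>1 / r y\<close>, which is the density of \<open>\<pi>\<close> with respect to
  \<open>\<pi>0\<close> up to the factor \<open>mean_holding\<close>.\<close>

lemma nn_integral_\<pi>:
  assumes g[measurable]: "g \<in> borel_measurable borel"
  shows "ennreal mean_holding * (\<integral>\<^sup>+y. g y \<partial>\<pi>) = (\<integral>\<^sup>+z. g (fst z) * snd z \<partial>\<Theta>)"
proof -
  note [measurable_cong] = sets_\<pi>0
  have "(\<integral>\<^sup>+z. g (fst z) * snd z \<partial>\<Theta>) = (\<integral>\<^sup>+y. \<integral>\<^sup>+s. g y * s \<partial>holding_law (r y) \<partial>\<pi>0)"
    by (subst nn_integral_with_holding[OF sets_\<pi>0]) (simp_all, measurable)
  also have "\<dots> = (\<integral>\<^sup>+y. g y * (1 / ennreal (r y)) \<partial>\<pi>0)"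
    by (simp add: nn_integral_cmult nn_integral_holding_law nn)
  also have "\<dots> = (\<integral>\<^sup>+y. ennreal mean_holding * (1 / ennreal (r y) / ennreal mean_holding * g y) \<partial>\<pi>0)"
  proof (rule nn_integral_cong)
    fix y
    have "ennreal mean_holding * (1 / ennreal (r y) / ennreal mean_holding) = 1 / ennreal (r y)"
      using mean_holding_pos
      by (subst ennreal_times_divide, subst mult.commute, intro mult_divide_eq_ennreal) auto
    then show "g y * (1 / ennreal (r y)) = ennreal mean_holding * (1 / ennreal (r y) / ennreal mean_holding * g y)"
      by (simp only: mult.assoc[symmetric]) (rule mult.commute)
  qed
  also have "\<dots> = ennreal mean_holding * (\<integral>\<^sup>+y. 1 / ennreal (r y) / ennreal mean_holding * g y \<partial>\<pi>0)"
    by (rule nn_integral_cmult) measurable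
  also have "(\<integral>\<^sup>+y. 1 / ennreal (r y) / ennreal mean_holding * g y \<partial>\<pi>0) = (\<integral>\<^sup>+y. g y \<partial>\<pi>)"
    unfolding ennreal_mean_holding[symmetric] by (rule nn_integral_density[symmetric]) measurable
  finally show ?thesis by simp
qed

lemma prob_\<pi>: "prob_space \<pi>"
proof
  have "ennreal mean_holding * (\<integral>\<^sup>+y. 1 \<partial>\<pi>) = ennreal mean_holding * 1"
    using nn_integral_\<pi>[of "\<lambda>_. 1"] by (simp add: \<Theta>_mean ennreal_mean_holding)
  then have "(\<integral>\<^sup>+y. 1 \<partial>\<pi>) = 1"
    using mean_holding_pos by (subst (asm) ennreal_mult_cancel_left) auto
  then show "emeasure \<pi> (space \<pi>) = 1" by simp
qed

lemma integral_holding_nonneg: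
  assumes fm[measurable]: "f \<in> borel_measurable borel" and f0: "\<And>y. 0 \<le> f y" and fB: "\<And>y. f y \<le> B"
  shows "(\<integral>z. f (fst z) * enn2real (snd z) \<partial>\<Theta>) = mean_holding * (\<integral>y. f y \<partial>\<pi>)"
proof -
  interpret \<pi>: prob_space \<pi> by (rule prob_\<pi>)
  note [measurable_cong] = sets_\<pi>0
  have "\<And>y. \<bar>f y\<bar> \<le> B" using f0 fB by simp
  then have i: "integrable \<Theta> (\<lambda>z. f (fst z) * enn2real (snd z))" "integrable \<pi> f"
    by (auto intro!: integrable_holding[OF fm] \<pi>.integrable_const_bound[where B=B])
  have "ennreal (\<integral>z. f (fst z) * enn2real (snd z) \<partial>\<Theta>) = (\<integral>\<^sup>+z. ennreal (f (fst z) * enn2real (snd z)) \<partial>\<Theta>)"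
    using i f0 by (intro nn_integral_eq_integral[symmetric]) auto
  also have "\<dots> = (\<integral>\<^sup>+z. ennreal (f (fst z)) * snd z \<partial>\<Theta>)"
    using AE_\<Theta>_finite f0
    by (intro nn_integral_cong_AE) (auto simp: less_top ennreal_mult elim!: eventually_mono)
  also have "\<dots> = ennreal mean_holding * (\<integral>\<^sup>+y. ennreal (f y) \<partial>\<pi>)"
    by (rule nn_integral_\<pi>[symmetric]) measurable
  also have "(\<integral>\<^sup>+y. ennreal (f y) \<partial>\<pi>) = ennreal (\<integral>y. f y \<partial>\<pi>)"
    using i f0 by (intro nn_integral_eq_integral) auto
  also have "ennreal mean_holding * \<dots> = ennreal (mean_holding * (\<integral>y. f y \<partial>\<pi>))"
    using mean_holding_pos f0 by (intro ennreal_mult[symmetric]) (auto intro: integral_nonneg_AE)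
  finally show ?thesis
    using mean_holding_pos f0 by (subst (asm) ennreal_inj) (auto intro!: integral_nonneg_AE mult_nonneg_nonneg)
qed

lemma integral_holding:
  assumes fm[measurable]: "f \<in> borel_measurable borel" and fB: "\<And>y. \<bar>f y\<bar> \<le> B"
  shows "(\<integral>z. f (fst z) * enn2real (snd z) \<partial>\<Theta>) = mean_holding * (\<integral>y. f y \<partial>\<pi>)"
proof -
  interpret \<pi>: prob_space \<pi> by (rule prob_\<pi>)
  note [measurable_cong] = sets_\<pi>0
  have i1: "integrable \<Theta> (\<lambda>z. f (fst z) * enn2real (snd z))" by (rule integrable_holding[OF fm fB])
  have i2: "integrable \<pi> f" using fB by (intro \<pi>.integrable_const_bound[where B=B]) auto
  have i3: "integrable \<Theta> (\<lambda>z. B * enn2real (snd z))" by (rule integrable_holding[of "\<lambda>_. B" "\<bar>B\<bar>"]) auto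
  \<comment> \<open>Adding \<open>B\<close> reduces to a nonnegative function; its contribution to
    both sides is \<open>B * mean_holding\<close>.\<close>
  have "0 \<le> f y + B" "f y + B \<le> 2 * B" for y using fB[of y] by auto
  then have "(\<integral>z. (f (fst z) + B) * enn2real (snd z) \<partial>\<Theta>) = mean_holding * (\<integral>y. f y + B \<partial>\<pi>)"
    by (intro integral_holding_nonneg[where B="2 * B"]) auto
  moreover have "(\<integral>z. (f (fst z) + B) * enn2real (snd z) \<partial>\<Theta>)
     = (\<integral>z. f (fst z) * enn2real (snd z) \<partial>\<Theta>) + B * mean_holding"
    using i1 i3 by (simp add: distrib_right mean_holding_def)
  moreover have "(\<integral>y. f y + B \<partial>\<pi>) = (\<integral>y. f y \<partial>\<pi>) + B"
    using i2 \<pi>.prob_space by simp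
  ultimately show ?thesis by (simp add: algebra_simps)
qed

lemma time_average_concentration:
  assumes fm[measurable]: "f \<in> borel_measurable borel" and fB: "\<And>y. \<bar>f y\<bar> \<le> B"
    and b: "0 < b" and \<epsilon>: "0 < \<epsilon>" and \<eta>: "0 < \<eta>"
  shows "\<exists>t0. \<forall>t\<ge>t0. \<forall>x. b \<le> r x \<longrightarrow>
    emeasure (ctmc_law r K x) {w \<in> space (ctmc_law r K x).
      \<bar>time_average f t w - (\<integral>y. f y \<partial>\<pi>)\<bar> > \<epsilon>} \<le> ennreal \<eta>"
proof -
  interpret \<pi>: prob_space \<pi> by (rule prob_\<pi>)
  note [measurable_cong] = sets_\<pi>0
  let ?m = mean_holding and ?pf = "\<integral>y. f y \<partial>\<pi>"
  note m = mean_holding_pos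
  define h where "h y = f y - ?pf" for y
  \<comment> \<open>The added 1 keeps \<open>G\<close> positive even when \<open>f\<close> vanishes,
    as the weak law requires.\<close>
  define G where "G = B + \<bar>?pf\<bar> + 1"
  have B0: "0 \<le> B" using fB abs_ge_zero order_trans by blast
  have [measurable]: "h \<in> borel_measurable borel" unfolding h_def by measurable
  have hG: "\<bar>h y\<bar> \<le> G" for y using fB[of y] by (simp add: h_def G_def)
  have G: "0 < G" using B0 by (simp add: G_def)
  have i2: "integrable \<pi> f" using fB by (intro \<pi>.integrable_const_bound[where B=B]) auto
  have h0: "(\<integral>z. h (fst z) * enn2real (snd z) \<partial>\<Theta>) = 0"
    using i2 \<pi>.prob_space by (subst integral_holding[OF _ hG]) (auto simp: h_def[abs_def])
  \<comment> \<open>On the good event the integral of \<open>h\<close> is at most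
    \<open>(1 + G) * (n * \<gamma>) + G * ?m\<close>. This value of \<gamma> turns the first term
    into \<open>n * ?m * (\<epsilon> / 2)\<close>, hence at most
    \<open>t * (\<epsilon> / 2)\<close>.\<close>
  define \<gamma> where "\<gamma> = \<epsilon> * ?m / (2 * (1 + G))"
  have \<gamma>: "0 < \<gamma>" using \<epsilon> m G by (simp add: \<gamma>_def)
  have "\<exists>n0. \<forall>n\<ge>n0. \<forall>x. b \<le> r x \<longrightarrow> measure (skeleton_law r K x)
    {w. n * \<gamma> < \<bar>(\<Sum>k<n. h (fst (w k)) * enn2real (snd (w k))) - n * (\<integral>z. h (fst z) * enn2real (snd z) \<partial>\<Theta>)\<bar>} \<le> \<eta> / 2"
    by (rule wlln_holding[OF _ hG G b \<gamma>]) (use \<eta> in auto)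
  then obtain n1 where n1: "\<And>n x. n1 \<le> n \<Longrightarrow> b \<le> r x \<Longrightarrow> measure (skeleton_law r K x)
    {w. n * \<gamma> < \<bar>\<Sum>k<n. h (fst (w k)) * enn2real (snd (w k))\<bar>} \<le> \<eta> / 2"
    by (auto simp: h0)
  have "\<exists>n0. \<forall>n\<ge>n0. \<forall>x. b \<le> r x \<longrightarrow> measure (skeleton_law r K x)
    {w. n * \<gamma> < \<bar>(\<Sum>k<n. 1 * enn2real (snd (w k))) - n * (\<integral>z. 1 * enn2real (snd z) \<partial>\<Theta>)\<bar>} \<le> \<eta> / 2"
    by (rule wlln_holding[where G=1]) (use \<eta> b \<gamma> in auto)
  then obtain n2 where n2: "\<And>n x. n2 \<le> n \<Longrightarrow> b \<le> r x \<Longrightarrow> measure (skeleton_law r K x)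
    {w. n * \<gamma> < \<bar>(\<Sum>k<n. enn2real (snd (w k))) - n * ?m\<bar>} \<le> \<eta> / 2"
    by (auto simp: mean_holding_def)
  \<comment> \<open>The three entries ensure in turn that the index \<open>n\<close> below exceeds
    \<open>n1\<close> and \<open>n2\<close>, that the rounding error \<open>G * ?m\<close> is at
    most \<open>t * (\<epsilon> / 2)\<close>, and that \<open>t\<close> is positive.\<close>
  define t0 where "t0 = max (max ((max n1 n2 + 1) * ?m) (2 * G * ?m / \<epsilon>)) 1"
  have "emeasure (ctmc_law r K x) {w \<in> space (ctmc_law r K x). \<bar>time_average f t w - ?pf\<bar> > \<epsilon>} \<le> ennreal \<eta>"
    if t: "t0 \<le> t" and x: "b \<le> r x" for t x
  proof -
    interpret P: prob_space "skeleton_law r K x" by (rule prob_space_skeleton_law)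
    let ?P = "skeleton_law r K x"
    have rx: "0 < r x" using b x by simp
    have t1: "(max n1 n2 + 1) * ?m \<le> t" "2 * G * ?m / \<epsilon> \<le> t" "0 < t" using t by (auto simp: t0_def)
    define n where "n = nat \<lfloor>t / ?m\<rfloor>"
    have fl: "n \<le> t / ?m" "t / ?m < n + 1" 
      using t1 m by (simp add: n_def, simp add: n_def, linarith)
    have nt: "n * ?m \<le> t" "t < n * ?m + ?m" using fl m by (auto simp: field_simps)
    have "(max n1 n2 + 1) \<le> t / ?m" using t1(1) m by (simp add: pos_le_divide_eq)
    with fl(2) have "real (max n1 n2) < n" by linarith
    then have nn12: "n1 \<le> n" "n2 \<le> n" by auto
    let ?A = "{w. n * \<gamma> < \<bar>\<Sum>k<n. h (fst (w k)) * enn2real (snd (w k))\<bar>}"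
    let ?B = "{w. n * \<gamma> < \<bar>(\<Sum>k<n. enn2real (snd (w k))) - n * ?m\<bar>}"
    have "?A = {w \<in> space ?P. n * \<gamma> < \<bar>\<Sum>k<n. h (fst (w k)) * enn2real (snd (w k))\<bar>}"
      by (simp add: space_skeleton_law)
    also have "\<dots> \<in> sets ?P" by measurable
    finally have A[measurable]: "?A \<in> sets ?P" .
    have "?B = {w \<in> space ?P. n * \<gamma> < \<bar>(\<Sum>k<n. enn2real (snd (w k))) - n * ?m\<bar>}"
      by (simp add: space_skeleton_law)
    also have "\<dots> \<in> sets ?P" by measurable
    finally have B[measurable]: "?B \<in> sets ?P" .
    have good: "\<bar>time_average f t (skeleton_path w) - ?pf\<bar> \<le> \<epsilon>"
      if w: "\<forall>k. snd (w k) \<noteq> \<infinity>" "(SUP n. jump_time w n) = \<infinity>" and nw: "w \<notin> ?A" "w \<notin> ?B" for w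
    proof -
      interpret nonexplosive_skeleton w h G using w hG by unfold_locales auto
      have "(LINT s:{0..t}|lborel. h (skeleton_path w s) + ?pf)
        = (LINT s:{0..t}|lborel. h (skeleton_path w s)) + (LINT s:{0..t}|lborel. ?pf)"
        using t1 by (intro set_integral_add path_integrable) (auto simp: set_integrable_def)
      also have "(LINT s:{0..t}|lborel. ?pf) = t * ?pf" using t1 by (simp add: set_lebesgue_integral_def)
      finally have "(LINT s:{0..t}|lborel. f (skeleton_path w s)) = (LINT s:{0..t}|lborel. h (skeleton_path w s)) + t * ?pf"
        by (simp add: h_def)
      then have "time_average f t (skeleton_path w) - ?pf = (LINT s:{0..t}|lborel. h (skeleton_path w s)) / t"
        using t1 by (simp add: time_average_def field_simps)
      then have "\<bar>time_average f t (skeleton_path w) - ?pf\<bar> = \<bar>LINT s:{0..t}|lborel. h (skeleton_path w s)\<bar> / t"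
        using t1 by simp
      also have "\<dots> \<le> \<epsilon>"
      proof -
        have "\<bar>LINT s:{0..t}|lborel. h (skeleton_path w s)\<bar>
          \<le> \<bar>\<Sum>k<n. h (fst (w k)) * enn2real (snd (w k))\<bar> + G * \<bar>t - T n\<bar>"
          using t1 by (intro integral_deviation) simp
        also have "\<dots> \<le> n * \<gamma> + G * (n * \<gamma> + ?m)"
        proof -
          have "\<bar>T n - n * ?m\<bar> \<le> n * \<gamma>" using nw(2) by (simp add: T_def not_less)
          then have "\<bar>t - T n\<bar> \<le> n * \<gamma> + ?m" using nt by linarith
          then have "G * \<bar>t - T n\<bar> \<le> G * (n * \<gamma> + ?m)" using G by (intro mult_left_mono) auto
          then show ?thesis using nw(1) by (simp add: not_less)
        qed
        also have "\<dots> = (1 + G) * (n * \<gamma>) + G * ?m" by (simp add: algebra_simps)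
        also have "(1 + G) * (n * \<gamma>) = n * ?m * (\<epsilon> / 2)" using G by (simp add: \<gamma>_def field_simps)
        also have "n * ?m * (\<epsilon> / 2) \<le> t * (\<epsilon> / 2)" using nt \<epsilon> by (intro mult_right_mono) auto
        also have "G * ?m \<le> t * (\<epsilon> / 2)" using t1(2) \<epsilon> by (simp add: field_simps)
        finally have "\<bar>LINT s:{0..t}|lborel. h (skeleton_path w s)\<bar> \<le> \<epsilon> * t" by (simp add: field_simps)
        then show ?thesis using t1 by (simp add: pos_divide_le_eq)
      qed
      finally show ?thesis .
    qed
    let ?E = "{w \<in> space (ctmc_law r K x). \<bar>time_average f t w - ?pf\<bar> > \<epsilon>}"
    \<comment> \<open>A non-measurable set has \<open>emeasure\<close> zero, so measurability of the event is not an issue.\<close>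
    show ?thesis
    proof (cases "?E \<in> sets (ctmc_law r K x)")
      case False
      then show ?thesis by (simp add: emeasure_notin_sets)
    next
      case True
      then have E: "?E \<in> sets skorokhod_space" by (simp add: ctmc_law_def)
      have "emeasure (ctmc_law r K x) ?E = emeasure ?P (skeleton_path -` ?E \<inter> space ?P)"
        unfolding ctmc_law_def using E by (intro emeasure_distr skeleton_path_measurable) (simp add: ctmc_law_def)
      also have "\<dots> \<le> emeasure ?P (?A \<union> ?B)"
      proof (rule emeasure_mono_AE)
        show "AE w in ?P. w \<in> skeleton_path -` ?E \<inter> space ?P \<longrightarrow> w \<in> ?A \<union> ?B"
          using AE_holding_finite[OF rx] AE_nonexplosive[OF rx]
        proof eventually_elim
          case (elim w)
          have "w \<in> ?A \<union> ?B" if "w \<in> skeleton_path -` ?E \<inter> space ?P"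
          proof (rule ccontr)
            assume "w \<notin> ?A \<union> ?B"
            then have "\<bar>time_average f t (skeleton_path w) - ?pf\<bar> \<le> \<epsilon>" using good[OF elim] by blast
            moreover have "\<bar>time_average f t (skeleton_path w) - ?pf\<bar> > \<epsilon>" using that by blast
            ultimately show False by simp
          qed
          then show ?case by blast
        qed
      qed measurable
      also have "\<dots> \<le> ennreal \<eta>"
        using measure_Un_le[OF A B] n1[OF nn12(1) x] n2[OF nn12(2) x] \<eta>
        by (auto simp: P.emeasure_eq_measure intro!: ennreal_leI)
      finally show ?thesis .
    qed
  qed
  then show ?thesis by blast
qed

end

section \<open>Convergence to the invariant measure\<close>

text \<open>By Fubini, a density fixed by the transposed kernel is the density of an invariant law.
  The regeneration series supplies such a density.\<close>

lemma invariant_prob_exists: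
  fixes lam :: "'b::second_countable_topology measure" and p :: "'b \<Rightarrow> 'b \<Rightarrow> real"
  assumes kernel: "K \<in> borel \<rightarrow>\<^sub>M prob_algebra borel"
    and lam: "prob_space lam" "sets lam = sets borel"
    and p_meas: "(\<lambda>(x, y). p x y) \<in> borel_measurable (borel \<Otimes>\<^sub>M borel)"
    and c: "0 < c" and p_ge: "\<And>x y. c \<le> p x y"
    and K_density: "\<And>x. K x = density lam (\<lambda>y. ennreal (p x y))"
  obtains \<mu> where "invariant_prob K \<mu>"
proof -
  interpret prob_space lam by fact
  interpret pair: pair_prob_space lam lam ..
  note [measurable_cong] = lam(2)
  have space_lam: "space lam = UNIV" using sets_eq_imp_space_eq[OF lam(2)] by simp
  have pm[measurable]: "(\<lambda>z. p (fst z) (snd z)) \<in> borel_measurable (borel \<Otimes>\<^sub>M borel)"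
    using p_meas by (simp add: case_prod_unfold)
  have [measurable]: "p x \<in> borel_measurable borel" for x
    using measurable_compose[OF measurable_Pair1'[of x] pm] by simp
  have [measurable]: "(\<lambda>x. p x y) \<in> borel_measurable borel" for y
    using measurable_compose[OF measurable_Pair2'[of y borel borel] pm] by simp
  have p_lam: "(\<lambda>(x, y). p x y) \<in> borel_measurable (lam \<Otimes>\<^sub>M lam)"
    using p_meas by (simp add: measurable_cong_sets[OF sets_pair_measure_cong[OF lam(2) lam(2)] refl])
  have p_int: "(\<integral>\<^sup>+y. ennreal (p x y) \<partial>lam) = 1" for x
  proof -
    have "prob_space (K x)" using measurable_space[OF kernel, of x] by (simp add: space_prob_algebra)
    then have "emeasure (K x) (space lam) = 1"
      using prob_space.emeasure_space_1[of "K x"] by (simp add: K_density)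
    then show ?thesis unfolding K_density
      by (subst (asm) emeasure_density) (auto simp: space_lam)
  qed
  obtain q where q[measurable]: "q \<in> borel_measurable lam" and q1: "(\<integral>\<^sup>+x. q x \<partial>lam) = 1"
    and qp: "\<And>y. y \<in> space lam \<Longrightarrow> (\<integral>\<^sup>+x. q x * ennreal (p x y) \<partial>lam) = q y"
    using invariant_density_exists[of lam p c, OF lam(1) p_lam c p_ge p_int] by blast
  let ?\<mu> = "density lam q"
  have Km: "K \<in> ?\<mu> \<rightarrow>\<^sub>M subprob_algebra borel"
    using measurable_prob_algebraD[OF kernel] by (simp add: measurable_cong_sets[OF lam(2) refl])
  have "?\<mu> \<bind> K = ?\<mu>"
  proof (rule measure_eqI)
    have ne: "space ?\<mu> \<noteq> {}" by (simp add: space_lam)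
    show "sets (?\<mu> \<bind> K) = sets ?\<mu>"
      using ne by (subst sets_bind[where N=borel]) (auto simp: K_density lam)
    fix A assume "A \<in> sets (?\<mu> \<bind> K)"
    then have A[measurable]: "A \<in> sets borel"
      using ne by (subst (asm) sets_bind[where N=borel]) (auto simp: K_density lam)
    have [measurable]: "(\<lambda>z. p (snd z) (fst z)) \<in> borel_measurable (borel \<Otimes>\<^sub>M borel)"
      using measurable_compose[OF _ pm, of "\<lambda>z. (snd z, fst z)"] by simp
    have "emeasure (?\<mu> \<bind> K) A = (\<integral>\<^sup>+x. emeasure (K x) A \<partial>?\<mu>)"
      by (rule emeasure_bind[OF ne Km A])
    also have "\<dots> = (\<integral>\<^sup>+x. (\<integral>\<^sup>+y. ennreal (p x y) * indicator A y \<partial>lam) \<partial>?\<mu>)"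
      unfolding K_density by (intro nn_integral_cong emeasure_density) (auto simp: lam)
    also have "\<dots> = (\<integral>\<^sup>+x. q x * (\<integral>\<^sup>+y. ennreal (p x y) * indicator A y \<partial>lam) \<partial>lam)"
      by (rule nn_integral_density) measurable
    also have "\<dots> = (\<integral>\<^sup>+x. \<integral>\<^sup>+y. q x * ennreal (p x y) * indicator A y \<partial>lam \<partial>lam)"
      by (simp add: nn_integral_cmult[symmetric] mult.assoc)
    also have "\<dots> = (\<integral>\<^sup>+y. \<integral>\<^sup>+x. q x * ennreal (p x y) * indicator A y \<partial>lam \<partial>lam)"
      by (rule pair.Fubini'[symmetric]) measurable
    also have "\<dots> = (\<integral>\<^sup>+y. q y * indicator A y \<partial>lam)"
      by (intro nn_integral_cong) (simp add: nn_integral_multc qp)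
    also have "\<dots> = emeasure ?\<mu> A" by (rule emeasure_density[symmetric]) measurable
    finally show "emeasure (?\<mu> \<bind> K) A = emeasure ?\<mu> A" .
  qed
  moreover have "prob_space ?\<mu>" by (rule prob_spaceI) (simp add: emeasure_density q1 cong: nn_integral_cong)
  ultimately show thesis using that[of ?\<mu>] by (simp add: invariant_prob_def lam)
qed

theorem theorem2p2:
  fixes r :: "'a::polish_space \<Rightarrow> real"
    and K :: "'a \<Rightarrow> 'a measure"
    and lam :: "'a measure"
    and p :: "'a \<Rightarrow> 'a \<Rightarrow> real"
    and \<delta> :: "nat \<Rightarrow> real"
    and f :: "'a \<Rightarrow> real"
  assumes compact_E: "compact (UNIV :: 'a set)"
    and r_nonneg: "\<And>x. 0 \<le> r x"
    and r_cont: "continuous_on UNIV r"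
    and kernel: "K \<in> borel \<rightarrow>\<^sub>M prob_algebra borel"
    and lam_prob: "prob_space lam" "sets lam = sets borel"
    and lam_pos: "\<And>U. open U \<Longrightarrow> U \<noteq> {} \<Longrightarrow> 0 < emeasure lam U"
    and p_cont: "continuous_on UNIV (\<lambda>(x, y). p x y)"
    and p_pos: "\<And>x y. 0 < p x y"
    and K_density: "\<And>x. K x = density lam (\<lambda>y. ennreal (p x y))"
    and inv_r_integrable: "(\<integral>\<^sup>+x. 1 / ennreal (r x) \<partial>lam) < \<infinity>"
    and \<delta>_pos: "\<And>n. 0 < \<delta> n"
    and \<delta>_lim: "\<delta> \<longlonglongrightarrow> 0"
    and \<delta>_ratio: "(SUP n. emeasure lam (slow_set r (2 * \<delta> n)) /
        emeasure lam (slow_set r (2 * \<delta> n) - slow_set r (\<delta> n))) < \<infinity>"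
    and f_cont: "continuous_on UNIV f"
  shows "(\<forall>x \<in> - {x. r x = 0}. \<forall>\<epsilon>>0.
           ((\<lambda>T. emeasure (ctmc_law r K x)
               {w \<in> space (ctmc_law r K x).
                  \<bar>time_average f T w - (\<integral>y. f y \<partial>ctmc_invariant r K)\<bar> > \<epsilon>})
            \<longlongrightarrow> 0) at_top)
       \<and> (\<forall>E1. compact E1 \<longrightarrow> E1 \<subseteq> - {x. r x = 0} \<longrightarrow> (\<forall>\<epsilon>>0.
           ((\<lambda>T. SUP x\<in>E1. emeasure (ctmc_law r K x)
               {w \<in> space (ctmc_law r K x).
                  \<bar>time_average f T w - (\<integral>y. f y \<partial>ctmc_invariant r K)\<bar> > \<epsilon>})
            \<longlongrightarrow> 0) at_top))"
proof -
  have compact_EE: "compact (UNIV :: ('a \<times> 'a) set)"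
    using compact_Times[OF compact_E compact_E] by simp
  obtain a1 a2 where "\<And>x y. p a1 a2 \<le> p x y"
    using continuous_attains_inf[OF compact_EE _ p_cont] by fastforce
  moreover define c where "c = p a1 a2"
  ultimately have c: "0 < c" and p_ge: "\<And>x y. c \<le> p x y" using p_pos by auto
  obtain b1 b2 where "\<And>x y. p x y \<le> p b1 b2"
    using continuous_attains_sup[OF compact_EE _ p_cont] by fastforce
  moreover define C where "C = p b1 b2"
  ultimately have p_le: "\<And>x y. p x y \<le> C" by auto
  obtain B where fB: "\<And>y. \<bar>f y\<bar> \<le> B"
    using compact_imp_bounded[OF compact_continuous_image[OF f_cont compact_E]]
    unfolding bounded_iff by auto
  have r_meas: "r \<in> borel_measurable borel" and f_meas: "f \<in> borel_measurable borel"
    using r_cont f_cont by (auto intro: borel_measurable_continuous_onI)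
  have p_meas: "(\<lambda>(x, y). p x y) \<in> borel_measurable (borel \<Otimes>\<^sub>M borel)"
    unfolding borel_prod by (rule borel_measurable_continuous_onI[OF p_cont])
  have px_meas: "p x \<in> borel_measurable borel" for x
    using measurable_compose[OF measurable_Pair1'[of x borel borel] p_meas] by simp
  have nn_K: "(\<integral>\<^sup>+y. g y \<partial>K x) = (\<integral>\<^sup>+y. ennreal (p x y) * g y \<partial>lam)"
    if "g \<in> borel_measurable borel" for g x
    unfolding K_density using that px_meas
    by (intro nn_integral_density) (auto simp: measurable_cong_sets[OF lam_prob(2) refl])
  have nn_cmult: "ennreal a * (\<integral>\<^sup>+y. g y \<partial>lam) = (\<integral>\<^sup>+y. ennreal a * g y \<partial>lam)"
    if "g \<in> borel_measurable borel" for g a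
    using that by (intro nn_integral_cmult[symmetric]) (auto simp: measurable_cong_sets[OF lam_prob(2) refl])
  have K_ge: "ennreal c * (\<integral>\<^sup>+y. g y \<partial>lam) \<le> (\<integral>\<^sup>+y. g y \<partial>K x)" if "g \<in> borel_measurable borel" for g x
    unfolding nn_K[OF that] nn_cmult[OF that] by (intro nn_integral_mono mult_right_mono ennreal_leI p_ge) simp
  have K_le: "(\<integral>\<^sup>+y. g y \<partial>K x) \<le> ennreal C * (\<integral>\<^sup>+y. g y \<partial>lam)" if "g \<in> borel_measurable borel" for g x
    unfolding nn_K[OF that] nn_cmult[OF that] by (intro nn_integral_mono mult_right_mono ennreal_leI p_le) simp
  obtain \<mu> where \<mu>: "invariant_prob K \<mu>"
    by (rule invariant_prob_exists[OF kernel lam_prob p_meas c p_ge K_density])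
  \<comment> \<open>Doeblin's condition for the states alone yields uniqueness of the invariant law,
    which identifies \<open>skeleton_invariant K\<close> with \<mu>.\<close>
  interpret base: doeblin_kernel borel K lam c
    by (rule doeblin_kernel.intro) (rule kernel lam_prob c | rule K_ge, assumption)+
  interpret jump_kernel r K
    by unfold_locales (rule r_meas r_nonneg kernel)+
  interpret ergodic_jump_kernel r K lam \<mu> c C
    by (rule ergodic_jump_kernel.intro[OF jump_kernel_axioms ergodic_jump_kernel_axioms.intro])
      (rule lam_prob c inv_r_integrable \<mu> | rule K_ge K_le, assumption)+
  have "skeleton_invariant K = \<mu>"
    unfolding skeleton_invariant_def
  proof (rule the_equality)
    show "invariant_prob K \<mu>" by (rule \<mu>)
    fix \<mu>' assume "invariant_prob K \<mu>'"
    then show "\<mu>' = \<mu>" using base.invariant_unique[of \<mu>' \<mu>] \<mu> by (simp only: invariant_prob_def)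
  qed
  then have \<pi>_eq: "ctmc_invariant r K = \<pi>" by (simp add: ctmc_invariant_def Let_def)
  have uniform: "((\<lambda>T. SUP x\<in>E1. emeasure (ctmc_law r K x)
      {w \<in> space (ctmc_law r K x). \<bar>time_average f T w - (\<integral>y. f y \<partial>ctmc_invariant r K)\<bar> > \<epsilon>})
      \<longlongrightarrow> 0) at_top"
    if E1: "compact E1" "E1 \<subseteq> - {x. r x = 0}" and \<epsilon>: "0 < \<epsilon>" for E1 \<epsilon>
  proof -
    \<comment> \<open>\<open>r\<close> is continuous and has no zero on the compact set
      \<open>E1\<close>, so its minimum there is positive; on the empty set any \<open>b\<close>
      serves.\<close>
    obtain b where b: "0 < b" "\<And>x. x \<in> E1 \<Longrightarrow> b \<le> r x"
    proof (cases "E1 = {}")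
      case True
      then show thesis using that[of 1] by auto
    next
      case False
      then obtain y where "y \<in> E1" "\<And>x. x \<in> E1 \<Longrightarrow> r y \<le> r x"
        using continuous_attains_inf[OF E1(1) False continuous_on_subset[OF r_cont]] by auto
      moreover have "0 < r y" using \<open>y \<in> E1\<close> E1(2) r_nonneg[of y] by auto
      ultimately show thesis using that by blast
    qed
    show ?thesis
    proof (rule order_tendstoI)
      fix a :: ennreal assume "0 < a"
      \<comment> \<open>A real number strictly below \<open>a\<close>, which may be infinite. The
        gap turns the non-strict bound on the supremum into a strict one.\<close>
      then obtain \<eta> where \<eta>: "0 < \<eta>" "ennreal \<eta> < a"
      proof -
        obtain z where z: "0 < z" "z < a" using dense[OF \<open>0 < a\<close>] by blast
        then have "z < top" by (auto intro: less_le_trans)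
        then have "0 < enn2real z" "ennreal (enn2real z) = z" using z by (auto simp: enn2real_positive_iff)
        then show thesis using that z by auto
      qed
      obtain t0 where t0: "\<And>t x. t0 \<le> t \<Longrightarrow> b \<le> r x \<Longrightarrow> emeasure (ctmc_law r K x)
        {w \<in> space (ctmc_law r K x). \<bar>time_average f t w - (\<integral>y. f y \<partial>\<pi>)\<bar> > \<epsilon>} \<le> ennreal \<eta>"
        using time_average_concentration[OF f_meas fB b(1) \<epsilon> \<eta>(1)] by blast
      show "\<forall>\<^sub>F T in at_top. (SUP x\<in>E1. emeasure (ctmc_law r K x)
        {w \<in> space (ctmc_law r K x). \<bar>time_average f T w - (\<integral>y. f y \<partial>ctmc_invariant r K)\<bar> > \<epsilon>}) < a"
        using eventually_ge_at_top[of t0]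
      proof eventually_elim
        case (elim t)
        show ?case unfolding \<pi>_eq
          by (rule le_less_trans[OF _ \<eta>(2)]) (rule SUP_least, rule t0[OF elim b(2)])
      qed
    qed simp
  qed
  show ?thesis
  proof (intro conjI ballI allI impI)
    fix x :: 'a and \<epsilon> :: real assume "x \<in> - {x. r x = 0}" "0 < \<epsilon>"
    then show "((\<lambda>T. emeasure (ctmc_law r K x)
        {w \<in> space (ctmc_law r K x). \<bar>time_average f T w - (\<integral>y. f y \<partial>ctmc_invariant r K)\<bar> > \<epsilon>})
        \<longlongrightarrow> 0) at_top"
      \<comment> \<open>Pointwise convergence is the uniform statement on the compact set
        \<open>{x}\<close>.\<close>
      using uniform[of "{x}" \<epsilon>] by simp
  qed (rule uniform)
qed

end
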